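(* Let $p\ge3$ be a prime, $0\le i\le p-1$, and $p\le r\equiv r_0\bmod p$ with $0\le r_0\le p-1$. If $r_0\ge i$, then as $M$-modules $$X_{r-i,\,r}\cong\begin{cases}X_{r-\Sigma_p(r-r_0),\,r-\Sigma_p(r-r_0)}\otimes V_{\Sigma_p(r-r_0)}, & \text{if } \Sigma_p(r-i)<r_0,\\ X_{r-i,\,r-i}\otimes V_i, & \text{if } \Sigma_p(r-i)\ge r_0.\end{cases}$$
   Context: Let $M=\mathrm{M}_2(\mathbb{F}_p)$, the multiplicative semigroup of $2\times2$ matrices, and $\Gamma=\mathrm{GL}_2(\mathbb{F}_p)$. For $n\ge0$, $V_n$ is the $\mathbb{F}_p$-space of homogeneous polynomials $F(X,Y)$ of degree $n$ over $\mathbb{F}_p$, with action of $M$ given by $\begin{pmatrix} a&b\\c&d\end{pmatrix}\cdot F(X,Y)=F(aX+cY,\,bX+dY)$. For $0\le l\le n$, $X_{n-l,\,n}\subseteq V_n$ is the $\mathbb{F}_p[\Gamma]$-submodule generated by $X^{n-l}Y^{l}$; those with $0\le l\le p-1$ occurring here are $M$-stable. Thus $X_{n,\,n}$ is generated by $X^n$. $\Sigma_p(n)$ is the sum of the base $p$ digits of $n$. *)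

theory Defs
  imports
    "HOL-Analysis.Determinants"
    "HOL-Computational_Algebra.Computational_Algebra"
    "HOL-Library.Poly_Mapping"
    "HOL-Number_Theory.Cong"
    "HOL-Algebra.Algebraic_Closure_Type"
begin

section \<open>Modules over the multiplicative monoid of two-by-two matrices\<close>

type_synonym 'k mat2 = "'k ^ 2 ^ 2"

text \<open>
  Only the additive group (\<^const>\<open>add\<close>, \<^const>\<open>zero\<close>) and the scalar multiplication of
  an HOL-Algebra module record are meaningful; its multiplicative fields are left
  \<^const>\<open>undefined\<close>.
\<close>

record ('k, 'v) mat2_module = "('k, 'v) module" +
  act :: "'k mat2 \<Rightarrow> 'v \<Rightarrow> 'v"

abbreviation field_ring :: "'k::field ring"
  where "field_ring \<equiv> ring_of_type_algebra"

definition is_mat2_module :: "('k::field, 'v) mat2_module \<Rightarrow> bool"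
  where "is_mat2_module V \<longleftrightarrow>
    Module.module field_ring V \<and>
    (\<forall>g. \<forall>x\<in>carrier V. act V g x \<in> carrier V) \<and>
    (\<forall>g. \<forall>x\<in>carrier V. \<forall>y\<in>carrier V.
       act V g (x \<oplus>\<^bsub>V\<^esub> y) = act V g x \<oplus>\<^bsub>V\<^esub> act V g y) \<and>
    (\<forall>g c. \<forall>x\<in>carrier V. act V g (c \<odot>\<^bsub>V\<^esub> x) = c \<odot>\<^bsub>V\<^esub> act V g x) \<and>
    (\<forall>x\<in>carrier V. act V (mat 1) x = x) \<and>
    (\<forall>g h. \<forall>x\<in>carrier V. act V (g ** h) x = act V g (act V h x))"

definition mat2_isomorphic ::
    "('k::field, 'v) mat2_module \<Rightarrow> ('k, 'w) mat2_module \<Rightarrow> bool"  (infix \<open>\<cong>\<^sub>M\<close> 50)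
  where "V \<cong>\<^sub>M W \<longleftrightarrow> is_mat2_module V \<and> is_mat2_module W \<and>
    (\<exists>\<phi>. \<phi> \<in> iso (add_monoid V) (add_monoid W) \<and>
      (\<forall>c. \<forall>x\<in>carrier V. \<phi> (c \<odot>\<^bsub>V\<^esub> x) = c \<odot>\<^bsub>W\<^esub> \<phi> x) \<and>
      (\<forall>g. \<forall>x\<in>carrier V. \<phi> (act V g x) = act W g (\<phi> x)))"


section \<open>Tensor products\<close>

definition quotient_module :: "('k, 'v) mat2_module \<Rightarrow> 'v set \<Rightarrow> ('k, 'v set) mat2_module"
  where "quotient_module V N =
    \<lparr>carrier = a_rcosets\<^bsub>V\<^esub> N, mult = undefined, one = undefined,
     zero = N, add = set_add V,
     module.smult = (\<lambda>c C. \<Union>x\<in>C. N +>\<^bsub>V\<^esub> (c \<odot>\<^bsub>V\<^esub> x)),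
     act = (\<lambda>g C. \<Union>x\<in>C. N +>\<^bsub>V\<^esub> act V g x)\<rparr>"

text \<open>
  The free vector space on the set of pairs \<open>carrier V \<times> carrier W\<close>; the basis
  vector at a pair \<open>u\<close> is \<open>Poly_Mapping.single u 1\<close>.
\<close>

definition free_module ::
    "('k::field, 'v) mat2_module \<Rightarrow> ('k, 'w) mat2_module \<Rightarrow> ('k, ('v \<times> 'w) \<Rightarrow>\<^sub>0 'k) mat2_module"
  where "free_module V W =
    \<lparr>carrier = {f. Poly_Mapping.keys f \<subseteq> carrier V \<times> carrier W},
     mult = undefined, one = undefined, zero = 0, add = (+),
     module.smult = (\<lambda>c. Poly_Mapping.map ((*) c)),
     act = (\<lambda>g f. \<Sum>(v, w)\<in>Poly_Mapping.keys f.
       Poly_Mapping.single (act V g v, act W g w) (Poly_Mapping.lookup f (v, w)))\<rparr>"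

definition bilinear_relations ::
    "('k::field, 'v) mat2_module \<Rightarrow> ('k, 'w) mat2_module \<Rightarrow> (('v \<times> 'w) \<Rightarrow>\<^sub>0 'k) set"
  where "bilinear_relations V W =
    (let e = (\<lambda>v w. Poly_Mapping.single (v, w) (1::'k)) in
      {e (v \<oplus>\<^bsub>V\<^esub> v') w - e v w - e v' w | v v' w.
         v \<in> carrier V \<and> v' \<in> carrier V \<and> w \<in> carrier W} \<union>
      {e v (w \<oplus>\<^bsub>W\<^esub> w') - e v w - e v w' | v w w'.
         v \<in> carrier V \<and> w \<in> carrier W \<and> w' \<in> carrier W} \<union>
      {e (c \<odot>\<^bsub>V\<^esub> v) w - Poly_Mapping.single (v, w) c | c v w.
         v \<in> carrier V \<and> w \<in> carrier W} \<union>
      {e v (c \<odot>\<^bsub>W\<^esub> w) - Poly_Mapping.single (v, w) c | c v w.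
         v \<in> carrier V \<and> w \<in> carrier W})"

definition tensor_module ::
    "('k::field, 'v) mat2_module \<Rightarrow> ('k, 'w) mat2_module \<Rightarrow>
      ('k, (('v \<times> 'w) \<Rightarrow>\<^sub>0 'k) set) mat2_module"  (infixl \<open>\<otimes>\<^sub>M\<close> 70)
  where "V \<otimes>\<^sub>M W =
    quotient_module (free_module V W)
      ((\<lambda>N. submodule N field_ring (free_module V W)) hull bilinear_relations V W)"


section \<open>Binary forms\<close>

text \<open>
  \<open>k[X, Y]\<close> is the type \<open>'k poly poly\<close>, with \<open>Y\<close> the outer variable: the coefficient of
  \<open>X\<^sup>i Y\<^sup>j\<close> in \<open>F\<close> is \<open>coeff (coeff F j) i\<close>.
\<close>

definition varX :: "'k::field poly poly" where "varX = [:[:0, 1:]:]"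

definition varY :: "'k::field poly poly" where "varY = [:0, 1:]"

definition const2 :: "'k::field \<Rightarrow> 'k poly poly" where "const2 c = [:[:c:]:]"

text \<open>\<open>subst2 F G H\<close> is \<open>F(G, H)\<close>.\<close>

definition subst2 :: "'k::field poly poly \<Rightarrow> 'k poly poly \<Rightarrow> 'k poly poly \<Rightarrow> 'k poly poly"
  where "subst2 F G H = poly (map_poly (\<lambda>q. poly (map_poly const2 q) G) F) H"

definition homogeneous2 :: "nat \<Rightarrow> 'k::field poly poly \<Rightarrow> bool"
  where "homogeneous2 n F \<longleftrightarrow> (\<forall>i j. coeff (coeff F j) i \<noteq> 0 \<longrightarrow> i + j = n)"

text \<open>The matrix with rows \<open>(a, b)\<close> and \<open>(c, d)\<close> sends \<open>F(X, Y)\<close> to \<open>F(aX + cY, bX + dY)\<close>.\<close>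

definition form_act :: "'k::field mat2 \<Rightarrow> 'k poly poly \<Rightarrow> 'k poly poly"
  where "form_act g F =
    subst2 F (const2 (g $ 1 $ 1) * varX + const2 (g $ 2 $ 1) * varY)
             (const2 (g $ 1 $ 2) * varX + const2 (g $ 2 $ 2) * varY)"

definition forms_on :: "'k::field poly poly set \<Rightarrow> ('k, 'k poly poly) mat2_module"
  where "forms_on S =
    \<lparr>carrier = S, mult = undefined, one = undefined, zero = 0, add = (+),
     module.smult = (\<lambda>c F. const2 c * F), act = form_act\<rparr>"

definition V_mod :: "nat \<Rightarrow> ('k::field, 'k poly poly) mat2_module"
  where "V_mod n = forms_on {F. homogeneous2 n F}"

definition GL2_submodule :: "nat \<Rightarrow> 'k::field poly poly set \<Rightarrow> bool"
  where "GL2_submodule n S \<longleftrightarrow>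
    submodule S field_ring (V_mod n) \<and> (\<forall>g. invertible g \<longrightarrow> (\<forall>F\<in>S. form_act g F \<in> S))"

text \<open>
  \<open>X_mod m n\<close> is generated by \<open>X\<^sup>m Y\<^sup>n\<^sup>-\<^sup>m\<close> over the group ring of \<open>GL\<^sub>2\<close> only; that it is
  stable under all of \<open>M\<^sub>2\<close> is not built in, it is part of \<^const>\<open>is_mat2_module\<close>.
  It is used for \<open>m \<le> n\<close>.
\<close>

definition X_mod :: "nat \<Rightarrow> nat \<Rightarrow> ('k::field, 'k poly poly) mat2_module"
  where "X_mod m n = forms_on (GL2_submodule n hull {varX ^ m * varY ^ (n - m)})"


section \<open>Digit sums\<close>

text \<open>For \<open>p \<ge> 2\<close> all digits of \<open>n\<close> at positions beyond \<open>n\<close> vanish.\<close>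

definition digit_sum :: "nat \<Rightarrow> nat \<Rightarrow> nat"
  where "digit_sum p n = (\<Sum>k\<le>n. n div p ^ k mod p)"

end

theory Submission
  imports Defs "HOL-Number_Theory.Residues"
begin

text \<open>
  Write \<open>k\<close> for the field, \<open>p\<close> for its cardinality, \<open>S n\<close> for the base-\<open>p\<close> digit sum of \<open>n\<close> and
  \<open>L\<^sub>v = aX + cY\<close> for a vector \<open>v = (a, c)\<close>.

  \<^bold>\<open>Shape of the modules.\<close> For \<open>l < p\<close> and \<open>m \<ge> 1\<close> the module generated by \<open>X\<^sup>m Y\<^sup>l\<close> is the span
  \<open>power_span m l\<close> of all \<open>L\<^sub>v\<^sup>m G\<close> with \<open>G\<close> a form of degree \<open>l\<close>: the powers \<open>(tX + Y)\<^sup>l\<close>, \<open>t \<in> k\<close>, span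
  the forms of degree \<open>l\<close> by a Vandermonde argument, and \<open>GL\<^sub>2\<close> moves \<open>X\<close> to any nonzero \<open>L\<^sub>v\<close>
  (\<open>GL2_hull_monomial\<close>). In this shape the stability under singular matrices is visible.

  \<^bold>\<open>The tensor product.\<close> Let \<open>n = d + pm\<close> with \<open>d + i < p\<close>. Multiplication of forms is an equivariant
  surjection from \<open>X\<^bsub>n,n\<^esub> \<otimes> V\<^sub>i\<close> onto \<open>X\<^bsub>n,n+i\<^esub>\<close>, so the point is its injectivity, which holds as soon as
  \<open>i \<le> S m\<close>. Since \<open>L\<^sub>v\<^sup>n\<close> is the product of \<open>L\<^sub>v\<^sup>d\<close> and the \<open>p\<close>-th power of \<open>L\<^sub>v\<^sup>m\<close>, the Frobenius map and
  induction on the digits give linearly independent forms \<open>\<epsilon>\<^sub>j\<close>, not depending on \<open>v\<close>, such that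
  \<open>L\<^sub>v\<^sup>n\<close> is the sum of the \<open>a\<^sup>j c\<^bsup>S n - j\<^esup> \<epsilon>\<^sub>j\<close> over \<open>j \<le> S n\<close> (\<open>digit_basis_exists\<close>). A relation
  \<open>F\<^sub>0 Y\<^sup>i + \<dots> + F\<^sub>i X\<^sup>i = 0\<close> with all \<open>F\<^sub>k\<close> in the span of the \<open>\<epsilon>\<^sub>j\<close> thereby becomes a homogeneous
  linear system with binomial coefficients (\<open>product_expansion\<close>). It splits according to \<open>j + k\<close>, and
  each part says that a polynomial \<open>(1 + z)\<^sup>d u(z)\<close> of degree less than \<open>p\<close> has at most \<open>d\<close> nonzero
  coefficients. As it vanishes to order \<open>d\<close> at \<open>-1\<close>, it must be zero (\<open>root_order_less_support\<close>,
  \<open>binomial_system_injective\<close>). Hence \<open>X\<^bsub>n,n+i\<^esub> \<cong> X\<^bsub>n,n\<^esub> \<otimes> V\<^sub>i\<close> (\<open>X_mod_tensor_V_mod\<close>).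

  \<^bold>\<open>The two cases.\<close> Put \<open>r = r\<^sub>0 + pm\<close> and \<open>s = S m\<close>. Then \<open>S (r - r\<^sub>0) = s\<close> and
  \<open>S (r - i) = r\<^sub>0 - i + s\<close>, so the case distinction is between \<open>s < i\<close> and \<open>i \<le> s\<close>. If \<open>i \<le> s\<close>, the
  isomorphism above applies directly. If \<open>s < i\<close>, then \<open>X\<^bsub>r-i,r\<^esub> = X\<^bsub>r-s,r\<^esub>\<close> (\<open>power_span_stabilises\<close>) and
  the isomorphism applies with \<open>s\<close> in place of \<open>i\<close>. The equality holds because \<open>X\<^bsub>r-i,r\<^esub>\<close> is contained in
  the span of the products \<open>X\<^sup>c Y\<^bsup>r0-c\<^esup> \<epsilon>\<^sub>b\<^sup>p\<close>, where now the \<open>\<epsilon>\<^sub>b\<close> belong to \<open>m\<close>, and because for \<open>i = s\<close>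
  the linear system is square: being injective it is also solvable, and its solutions exhibit all
  these products as elements of \<open>X\<^bsub>r-s,r\<^esub>\<close>.
\<close>

section \<open>Binary forms and their matrix action\<close>

lemma const2_hom:
  "const2 (0::'k::field) = 0" "const2 (1::'k) = 1" "const2 (a + b) = const2 a + const2 b"
  "const2 (a * b) = const2 a * const2 b" "const2 (- a) = - const2 a"
  "const2 (a - b) = const2 a - const2 b" for a b :: "'k::field"
  by (simp_all add: const2_def one_pCons)

lemma const2_power: "const2 (c ^ n) = const2 c ^ n"
  by (induction n) (simp_all add: const2_hom)

lemma const2_of_nat: "const2 (of_nat n) = of_nat n"
  by (induction n) (simp_all add: const2_hom)

lemma const2_sum: "const2 (sum f A) = (\<Sum>x\<in>A. const2 (f x))"
  by (induction A rule: infinite_finite_induct) (simp_all add: const2_hom)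

lemma const2_mult_eq: "const2 c * F = Polynomial.smult [:c:] F"
  by (simp add: const2_def)

lemma coeff_const2_mult: "coeff (coeff (const2 c * F) j) i = c * coeff (coeff F j) i"
  by (simp add: const2_mult_eq)

interpretation forms: vector_space "\<lambda>(c::'k::field) F. const2 c * F"
  by unfold_locales (simp_all add: const2_hom algebra_simps)

(* Merging scalars would undo const2_hom, which splits them. *)
declare forms.scale_scale [simp del]

text \<open>
  Serves to show that two algebra endomorphisms of \<open>k[X, Y]\<close> agreeing on \<open>X\<close>, \<open>Y\<close> and the constants
  are equal, as needed for the action of a product of matrices.
\<close>

lemma form_induct [case_names add const mX mY]:
  assumes "\<And>F G. P F \<Longrightarrow> P G \<Longrightarrow> P (F + G)"
    and "\<And>c. P (const2 c)" and "\<And>F. P F \<Longrightarrow> P (varX * F)" and "\<And>F. P F \<Longrightarrow> P (varY * F)"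
  shows "P F"
proof (induction F rule: pCons_induct)
  case 0
  show ?case using assms(2)[of 0] by (simp add: const2_hom)
next
  case (pCons q F)
  have "P [:q:]"
  proof (induction q rule: pCons_induct)
    case 0
    show ?case using assms(2)[of 0] by (simp add: const2_hom)
  next
    case (pCons a q)
    have "[:pCons a q:] = const2 a + varX * [:q:]"
      by (simp add: const2_def varX_def)
    then show ?case using assms pCons by metis
  qed
  moreover have "pCons q F = [:q:] + varY * F"
    by (simp add: varY_def)
  ultimately show ?case using assms pCons by metis
qed

lemma poly_map_poly_hom:
  fixes h :: "'a::comm_ring_1 \<Rightarrow> 'b::comm_ring_1" and z :: 'b
  assumes "h 0 = 0" "h 1 = 1" "\<And>x y. h (x + y) = h x + h y" "\<And>x y. h (x * y) = h x * h y"
  defines "e \<equiv> \<lambda>F. poly (map_poly h F) z"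
  shows "e 0 = 0" "e 1 = 1" "e (F + G) = e F + e G" "e (F * G) = e F * e G"
    "e [:a:] = h a" "e [:0, 1:] = z"
proof -
  have p: "e (pCons a F) = h a + z * e F" for a F
    by (simp add: e_def map_poly_pCons assms(1))
  show z: "e 0 = 0" by (simp add: e_def)
  show c: "e [:a:] = h a" for a by (simp add: p z)
  show "e 1 = 1" by (simp add: one_pCons c assms(2))
  show "e [:0, 1:] = z" by (simp add: p z assms(1,2))
  show a: "e (F + G) = e F + e G" for F G
    by (induction F G rule: poly_induct2) (simp_all add: p z assms(3) algebra_simps)
  have s: "e (Polynomial.smult a F) = h a * e F" for a F
    by (induction F) (simp_all add: p z assms(4) algebra_simps)
  show "e (F * G) = e F * e G"
    by (induction F) (simp_all add: p z a s assms(1) algebra_simps)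
qed

lemma subst2_hom:
  "subst2 0 A B = 0" "subst2 (F + G) A B = subst2 F A B + subst2 G A B"
  "subst2 1 A B = 1" "subst2 (F * G) A B = subst2 F A B * subst2 G A B"
  "subst2 (const2 c) A B = const2 c" "subst2 varX A B = A" "subst2 varY A B = B"
proof -
  note h = poly_map_poly_hom[where h = "const2" and z = A, OF const2_hom(1-4)]
  note H = poly_map_poly_hom[where h = "\<lambda>q. poly (map_poly const2 q) A" and z = B, OF h(1-4)]
  show "subst2 0 A B = 0" "subst2 (F + G) A B = subst2 F A B + subst2 G A B"
    "subst2 1 A B = 1" "subst2 (F * G) A B = subst2 F A B * subst2 G A B"
    "subst2 varY A B = B"
    using H by (simp_all add: subst2_def varY_def)
  show "subst2 (const2 c) A B = const2 c" "subst2 varX A B = A"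
    using H(5) h(5,6) by (simp_all add: subst2_def varX_def const2_def)
qed

definition linform :: "'k::field ^ 2 \<Rightarrow> 'k poly poly"
  where "linform v = const2 (v $ 1) * varX + const2 (v $ 2) * varY"

lemma form_act_hom:
  "form_act g 0 = 0" "form_act g (F + G) = form_act g F + form_act g G"
  "form_act g 1 = 1" "form_act g (F * G) = form_act g F * form_act g G"
  "form_act g (const2 c) = const2 c"
  by (simp_all add: form_act_def subst2_hom)

lemma form_act_power: "form_act g (F ^ n) = form_act g F ^ n"
  by (induction n) (simp_all add: form_act_hom)

lemma form_act_sum: "form_act g (sum f A) = (\<Sum>x\<in>A. form_act g (f x))"
  by (induction A rule: infinite_finite_induct) (simp_all add: form_act_hom)

lemma form_act_var:
  "form_act g varX = linform (g *v axis 1 1)" "form_act g varY = linform (g *v axis 2 1)"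
  by (simp_all add: form_act_def subst2_hom linform_def matrix_vector_mult_def axis_def if_distrib
    cong: if_cong)

lemma linform_axis [simp]: "linform (axis 1 1) = varX" "linform (axis 2 1) = varY"
  by (simp_all add: linform_def axis_def const2_hom)

lemma form_act_linform: "form_act g (linform v) = linform (g *v v)"
  by (simp add: linform_def form_act_hom form_act_var matrix_vector_mult_def sum_2 axis_def
      const2_hom algebra_simps)

lemma form_act_mult: "form_act (g ** h) F = form_act g (form_act h F)"
  by (induction F rule: form_induct)
     (simp_all add: form_act_hom form_act_var form_act_linform matrix_vector_mul_assoc)

lemma form_act_one: "form_act (mat 1) F = F"
  by (induction F rule: form_induct) (simp_all add: form_act_hom form_act_var)

lemma homogeneous2_coeff: "homogeneous2 n F \<Longrightarrow> i + j \<noteq> n \<Longrightarrow> coeff (coeff F j) i = 0"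
  by (auto simp: homogeneous2_def)

lemma homogeneous2_closed:
  "homogeneous2 n 0" "homogeneous2 0 (const2 c)" "homogeneous2 1 varX" "homogeneous2 1 varY"
  "homogeneous2 n F \<Longrightarrow> homogeneous2 n G \<Longrightarrow> homogeneous2 n (F + G)"
  by (auto simp: homogeneous2_def const2_def varX_def varY_def coeff_pCons split: nat.splits)
     (metis add_0)+

lemma homogeneous2_mult:
  assumes "homogeneous2 m F" "homogeneous2 n G"
  shows "homogeneous2 (m + n) (F * G)"
  unfolding homogeneous2_def
proof (intro allI impI)
  fix i j assume "coeff (coeff (F * G) j) i \<noteq> 0"
  then have "(\<Sum>b\<le>j. coeff (coeff F b * coeff G (j - b)) i) \<noteq> 0"
    by (simp add: coeff_mult[of F G] coeff_sum)
  then obtain b where b: "b \<le> j" "coeff (coeff F b * coeff G (j - b)) i \<noteq> 0"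
    by (metis (no_types, lifting) atMost_iff sum.neutral)
  then have "(\<Sum>a\<le>i. coeff (coeff F b) a * coeff (coeff G (j - b)) (i - a)) \<noteq> 0"
    by (simp add: coeff_mult[of "coeff F b"])
  then obtain a where a: "a \<le> i" "coeff (coeff F b) a * coeff (coeff G (j - b)) (i - a) \<noteq> 0"
    by (metis (no_types, lifting) atMost_iff sum.neutral)
  have "a + b = m" "(i - a) + (j - b) = n"
    using a assms by (auto simp: homogeneous2_def)
  then show "i + j = m + n" using a b by linarith
qed

lemma homogeneous2_power: "homogeneous2 m F \<Longrightarrow> homogeneous2 (n * m) (F ^ n)"
  using homogeneous2_mult[of m F]
  by (induction n) (use homogeneous2_closed(2)[of 1] in \<open>auto simp: const2_hom\<close>)

lemma homogeneous2_linform: "homogeneous2 1 (linform v)"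
  using homogeneous2_mult[OF homogeneous2_closed(2,3)] homogeneous2_mult[OF homogeneous2_closed(2,4)]
  by (auto simp: linform_def intro!: homogeneous2_closed(5))

lemma homogeneous2_linform_power: "homogeneous2 n (linform v ^ n)"
  using homogeneous2_power[OF homogeneous2_linform, of n] by simp

lemma coeff_monomial2:
  "coeff (coeff (varX ^ a * varY ^ b) j) i = (if j = b \<and> i = a then 1 else 0)"
proof -
  have "varX ^ a = [:monom (1::'a) a:]"
    by (simp add: varX_def monom_altdef poly_const_pow)
  moreover have "varY ^ b = monom (1::'a poly) b"
    by (simp add: varY_def monom_altdef)
  ultimately show ?thesis by simp
qed

lemma homogeneous2_sum:
  "(\<And>x. x \<in> A \<Longrightarrow> homogeneous2 n (f x)) \<Longrightarrow> homogeneous2 n (sum f A)"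
  by (induction A rule: infinite_finite_induct) (auto intro: homogeneous2_closed)

lemma homogeneous2_const2_mult: "homogeneous2 n F \<Longrightarrow> homogeneous2 n (const2 c * F)"
  using homogeneous2_mult[OF homogeneous2_closed(2)] by fastforce

lemma homogeneous2_monomial: "homogeneous2 (a + b) (varX ^ a * varY ^ b)"
  by (auto simp: homogeneous2_def coeff_monomial2)

lemma homogeneous2_expansion:
  assumes "homogeneous2 n F"
  shows "F = (\<Sum>k\<le>n. const2 (coeff (coeff F (n - k)) k) * (varX ^ k * varY ^ (n - k)))"
proof (intro poly_eqI)
  fix j i
  have "coeff (coeff (\<Sum>k\<le>n. const2 (coeff (coeff F (n - k)) k) * (varX ^ k * varY ^ (n - k))) j) i
     = (\<Sum>k\<le>n. if k = i then (if j = n - i then coeff (coeff F j) i else 0) else 0)"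
    unfolding coeff_sum coeff_const2_mult coeff_monomial2 by (intro sum.cong) auto
  also have "\<dots> = coeff (coeff F j) i"
    using homogeneous2_coeff[OF assms, of i j] by auto
  finally show "coeff (coeff F j) i = coeff (coeff (\<Sum>k\<le>n. const2 (coeff (coeff F (n - k)) k) *
      (varX ^ k * varY ^ (n - k))) j) i" by simp
qed

lemma homogeneous2_form_act:
  assumes "homogeneous2 n F"
  shows "homogeneous2 n (form_act g F)"
proof -
  have *: "homogeneous2 n (linform v ^ k * linform w ^ (n - k))" if "k \<le> n" for k v w
    using homogeneous2_mult[OF homogeneous2_linform_power[of k v] homogeneous2_linform_power[of "n - k" w]]
      that by simp
  show ?thesis
    by (subst homogeneous2_expansion[OF assms])
       (auto simp: form_act_sum form_act_hom form_act_power form_act_var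
         intro!: homogeneous2_sum homogeneous2_const2_mult *)
qed

section \<open>A linear system with binomial coefficients\<close>

text \<open>
  A polynomial vanishing to order \<open>n\<close> at a nonzero point has more than \<open>n\<close> terms, provided that its
  exponents stay distinct in the field. The operator \<open>z d/dz - e\<close> removes the term of exponent \<open>e\<close>, keeps
  all others, and lowers the order of vanishing by at most one; induction on \<open>n\<close> does the rest.
\<close>

lemma root_order_less_support:
  fixes P :: "'k::field poly"
  assumes "P \<noteq> 0" "[:- a, 1:] ^ n dvd P" "a \<noteq> 0"
    and "inj_on (of_nat :: nat \<Rightarrow> 'k) {e. coeff P e \<noteq> 0}"
  shows "n < card {e. coeff P e \<noteq> 0}"
  using assms
proof (induction n arbitrary: P)
  case 0
  have "finite {e. coeff P e \<noteq> 0}"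
    by (rule finite_subset[of _ "{..degree P}"]) (auto intro: le_degree)
  moreover have "{e. coeff P e \<noteq> 0} \<noteq> {}"
    using 0 by (auto simp: poly_eq_iff)
  ultimately show ?case by (simp add: card_gt_0_iff)
next
  case (Suc n)
  let ?S = "\<lambda>P. {e. coeff P e \<noteq> (0::'k)}"
  have fin: "finite (?S P)"
    by (rule finite_subset[of _ "{..degree P}"]) (auto intro: le_degree)
  obtain e where e: "coeff P e \<noteq> 0"
    using Suc.prems(1) by (auto simp: poly_eq_iff)
  \<comment> \<open>\<open>R = z P' - e P\<close>\<close>
  define R where "R = pCons 0 (pderiv P) - Polynomial.smult (of_nat e) P"
  have cR: "coeff R k = (of_nat k - of_nat e) * coeff P k" for k
    by (cases k) (simp_all add: R_def coeff_pderiv algebra_simps)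
  have SR: "?S R = ?S P - {e}"
    using Suc.prems(4) e by (auto simp: cR inj_on_def)
  obtain Q where Q: "P = [:- a, 1:] ^ Suc n * Q"
    using Suc.prems(2) by blast
  have "pderiv (q ^ Suc n * Q) = q ^ n * (q * pderiv Q + Polynomial.smult (of_nat (Suc n)) (Q * pderiv q))"
    for q :: "'k poly"
    unfolding pderiv_mult pderiv_power_Suc
    by (simp only: power_Suc mult_smult_right distrib_left mult_ac)
  then have "[:- a, 1:] ^ n dvd pderiv P" unfolding Q by (metis dvd_triv_left)
  then have "[:- a, 1:] ^ n dvd [:0, 1:] * pderiv P" by (rule dvd_mult)
  moreover have "[:- a, 1:] ^ n dvd P"
    using Suc.prems(2) by (rule dvd_trans[rotated]) (simp add: le_imp_power_dvd del: power_Suc)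
  ultimately have R: "[:- a, 1:] ^ n dvd R"
    unfolding R_def by (intro dvd_diff dvd_smult) simp_all
  show ?case
  proof (cases "R = 0")
    case True
    then have "?S P = {e}" using SR e by auto
    then have "P = monom (coeff P e) e"
      by (intro poly_eqI) (auto simp: set_eq_iff)
    then have "poly P a = coeff P e * a ^ e"
      by (metis poly_monom)
    moreover have "poly P a = 0" by (simp add: Q)
    ultimately show ?thesis using e Suc.prems(3) by simp
  next
    case False
    have "Suc n \<le> card (?S R)"
      using False R Suc.prems(3,4) SR by (intro Suc_leI Suc.IH) (auto intro: inj_on_subset)
    also have "card (?S R) < card (?S P)"
      unfolding SR using e fin by (intro psubset_card_mono) auto
    finally show ?thesis .
  qed
qed

text \<open>
  The unknowns with \<open>j + k = d\<close> form one block. With \<open>u(z) = \<Sum> a (d - k) k z\<^sup>k\<close>, the equations of this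
  block say that the coefficients of \<open>P = (1 + z)\<^sup>n u(z)\<close> vanish at all exponents between \<open>d - s\<close>
  and \<open>d\<close>. Since \<open>i \<le> s\<close>, this window leaves room for at most \<open>n\<close> nonzero coefficients, too few for a
  nonzero polynomial with a root of order \<open>n\<close> at \<open>-1\<close>.
\<close>

lemma binomial_system_injective:
  fixes a :: "nat \<Rightarrow> nat \<Rightarrow> 'k::field"
  assumes inj: "inj_on (of_nat :: nat \<Rightarrow> 'k) {..n + i}" and "i \<le> s"
    and eq: "\<And>c b. c \<le> n + i \<Longrightarrow> b \<le> s \<Longrightarrow>
      (\<Sum>l\<le>n. \<Sum>k\<le>i. if l + k = c then of_nat (n choose l) * a (l + b) k else 0) = 0"
    and j: "j \<le> n + s" and k: "k \<le> i"
  shows "a j k = 0"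
proof -
  define d where "d = j + k"
  define u where "u k = (if k \<le> i \<and> k \<le> d \<and> d - k \<le> n + s then a (d - k) k else 0)" for k
  define U where "U = (\<Sum>k\<le>i. monom (u k) k)"
  have U: "coeff U k = u k" for k
    by (auto simp: U_def coeff_sum u_def sum.delta')
  define P where "P = [:1, 1:] ^ n * U"
  have P: "coeff P c = (\<Sum>l\<le>c. of_nat (n choose l) * u (c - l))" for c
  proof -
    have "coeff ([:1, 1:] ^ n) l = (of_nat (n choose l) :: 'k)" for l
    proof (cases "l \<le> n")
      case True
      then show ?thesis by (subst coeff_linear_poly_power) simp_all
    next
      case False
      then have "degree ([:1, 1:] ^ n :: 'k poly) < l" by (simp only: degree_linear_power not_le)
      then show ?thesis using False by (simp add: coeff_eq_0 binomial_eq_0 del: mult_pCons_left)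
    qed
    then show ?thesis by (simp add: P_def coeff_mult U)
  qed
  have zero: "coeff P c = 0" if c: "c \<le> n + i" "c \<le> d" "d - c \<le> s" for c
  proof -
    have "coeff P c = (\<Sum>l\<le>n. if l \<le> c \<and> c - l \<le> i then of_nat (n choose l) * u (c - l) else 0)"
      unfolding P by (rule sum.mono_neutral_cong) (auto simp: u_def binomial_eq_0)
    also have "\<dots> = (\<Sum>l\<le>n. \<Sum>k\<le>i. if l + k = c then of_nat (n choose l) * a (l + (d - c)) k else 0)"
    proof (intro sum.cong refl)
      fix l assume l: "l \<in> {..n}"
      show "(if l \<le> c \<and> c - l \<le> i then of_nat (n choose l) * u (c - l) else 0) =
        (\<Sum>k\<le>i. if l + k = c then of_nat (n choose l) * a (l + (d - c)) k else 0)"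
      proof (cases "l \<le> c")
        case True
        then have *: "l + k = c \<longleftrightarrow> k = c - l" for k by auto
        have "d - (c - l) = l + (d - c)" using True c by auto
        then show ?thesis using True c l unfolding * by (auto simp: u_def)
      qed auto
    qed
    also have "\<dots> = 0" using c by (intro eq) auto
    finally show ?thesis .
  qed
  \<comment> \<open>Here subtraction truncates: an interval disappears when the window reaches the end of the
    possible exponents.\<close>
  have supp: "{c. coeff P c \<noteq> 0} \<subseteq> {d - (n + s)..<d - s} \<union> {Suc d..n + min i d}"
  proof
    fix c assume "c \<in> {c. coeff P c \<noteq> 0}"
    then have c: "coeff P c \<noteq> 0" by simp
    then obtain l where l: "l \<le> c" "of_nat (n choose l) * u (c - l) \<noteq> 0"
      unfolding P by (metis (no_types, lifting) atMost_iff sum.neutral)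
    then have "l \<le> n" using binomial_eq_0[of n l] by (cases "l \<le> n") auto
    moreover from l have "c - l \<le> i" "c - l \<le> d" "d - (c - l) \<le> n + s"
      by (auto simp: u_def split: if_splits)
    moreover from calculation have "\<not> (c \<le> d \<and> d - c \<le> s)" using zero c l(1) by auto
    ultimately show "c \<in> {d - (n + s)..<d - s} \<union> {Suc d..n + min i d}" using l(1) by auto
  qed
  have "card {c. coeff P c \<noteq> 0} \<le> card ({d - (n + s)..<d - s} \<union> {Suc d..n + min i d})"
    using supp by (intro card_mono) auto
  also have "\<dots> \<le> (d - s - (d - (n + s))) + (n + min i d - d)"
    by (rule order.trans[OF card_Un_le]) simp
  also have "\<dots> \<le> n" proof (cases "d \<le> s")
    case True
    then show ?thesis by simp
  next
    case False
    then have m: "min i d = i" using \<open>i \<le> s\<close> by simp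
    have "d - s - (d - (n + s)) \<le> n" "d - s - (d - (n + s)) \<le> d - s" by linarith+
    then show ?thesis unfolding m using False \<open>i \<le> s\<close> by linarith
  qed
  finally have "card {c. coeff P c \<noteq> 0} \<le> n" .
  moreover have "inj_on (of_nat :: nat \<Rightarrow> 'k) {c. coeff P c \<noteq> 0}"
  proof (rule inj_on_subset[OF inj])
    have "d - s \<le> n + i" using j k unfolding d_def by linarith
    then have "{d - (n + s)..<d - s} \<union> {Suc d..n + min i d} \<subseteq> {..n + i}" by auto
    then show "{c. coeff P c \<noteq> 0} \<subseteq> {..n + i}" using supp by blast
  qed
  ultimately have "P = 0"
    using root_order_less_support[of P "- 1" n] by (auto simp: P_def)
  then have "U = 0" by (simp add: P_def)
  then have "u k = 0" using U[of k] by simp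
  then show ?thesis using j k by (simp add: u_def d_def)
qed

text \<open>
  For \<open>i = s\<close> unknowns and equations are indexed by the same finite set, so over a finite field
  injectivity gives surjectivity by counting.
\<close>

lemma binomial_system_solvable:
  fixes A :: "nat \<Rightarrow> nat \<Rightarrow> 'k::{field,finite}"
  assumes inj: "inj_on (of_nat :: nat \<Rightarrow> 'k) {..n + s}"
  shows "\<exists>a. \<forall>c\<le>n + s. \<forall>b\<le>s.
    (\<Sum>l\<le>n. \<Sum>k\<le>s. if l + k = c then of_nat (n choose l) * a (l + b) k else 0) = A c b"
proof -
  define I where "I = {..n + s} \<times> {..s}"
  define E where "E = (I \<rightarrow>\<^sub>E (UNIV :: 'k set))"
  define T where "T a = (\<lambda>(c, b)\<in>I. \<Sum>l\<le>n. \<Sum>k\<le>s.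
    if l + k = c then of_nat (n choose l) * a (l + b, k) else 0)" for a :: "nat \<times> nat \<Rightarrow> 'k"
  have "inj_on T E"
  proof (rule inj_onI)
    fix x y assume xy: "x \<in> E" "y \<in> E" "T x = T y"
    define a where "a j k = x (j, k) - y (j, k)" for j k
    have z: "a j k = 0" if "j \<le> n + s" "k \<le> s" for j k
    proof (rule binomial_system_injective[where i = s and s = s and n = n])
      fix c b assume "c \<le> n + s" "b \<le> s"
      then have "(c, b) \<in> I" by (simp add: I_def)
      then have "(\<Sum>l\<le>n. \<Sum>k\<le>s. if l + k = c then of_nat (n choose l) * x (l + b, k) else 0) =
          (\<Sum>l\<le>n. \<Sum>k\<le>s. if l + k = c then of_nat (n choose l) * y (l + b, k) else 0)"
        using fun_cong[OF xy(3), of "(c, b)"] by (simp add: T_def)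
      moreover have "(\<Sum>l\<le>n. \<Sum>k\<le>s. if l + k = c then of_nat (n choose l) * a (l + b) k else 0) =
          (\<Sum>l\<le>n. \<Sum>k\<le>s. if l + k = c then of_nat (n choose l) * x (l + b, k) else 0) -
          (\<Sum>l\<le>n. \<Sum>k\<le>s. if l + k = c then of_nat (n choose l) * y (l + b, k) else 0)"
        unfolding sum_subtractf[symmetric] by (intro sum.cong refl) (simp add: a_def algebra_simps)
      ultimately show "(\<Sum>l\<le>n. \<Sum>k\<le>s. if l + k = c then of_nat (n choose l) * a (l + b) k else 0) = 0"
        by simp
    qed (use inj that in auto)
    show "x = y"
      using xy(1,2) unfolding E_def
      by (rule PiE_ext) (use z in \<open>auto simp: I_def a_def\<close>)
  qed
  moreover have "T ` E \<subseteq> E" by (auto simp: T_def E_def)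
  moreover have "finite E" unfolding E_def I_def by (intro finite_PiE) auto
  ultimately have "T ` E = E" by (metis endo_inj_surj)
  moreover have "(\<lambda>(c, b)\<in>I. A c b) \<in> E" by (auto simp: E_def)
  ultimately obtain x where "T x = (\<lambda>(c, b)\<in>I. A c b)" by (metis imageE)
  then have "T x (c, b) = A c b" if "(c, b) \<in> I" for c b using that by simp
  then show ?thesis
    by (intro exI[of _ "\<lambda>j k. x (j, k)"]) (simp add: T_def I_def)
qed

text \<open>
  The Vandermonde argument: a vector-valued polynomial of degree at most \<open>N\<close> with more than \<open>N\<close> values in
  a subspace has all coefficients there. Dividing the difference to the value at one point \<open>t0\<close> by
  \<open>t - t0\<close> lowers the degree.
\<close>

lemma (in vector_space) coefficients_in_subspace:
  assumes S: "subspace S" and "finite T" "N < card T"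
    and "\<And>t. t \<in> T \<Longrightarrow> (\<Sum>k\<le>N. scale (t ^ k) (D k)) \<in> S"
    and "k \<le> N"
  shows "D k \<in> S"
  using assms(2-)
proof (induction N arbitrary: D T k)
  case 0
  then obtain t where "t \<in> T" by fastforce
  then show ?case using 0 by force
next
  case (Suc N)
  then obtain t0 where t0: "t0 \<in> T" by fastforce
  define E where "E a = (\<Sum>k = Suc a..Suc N. scale (t0 ^ (k - Suc a)) (D k))" for a
  have E: "E a \<in> S" if a: "a \<le> N" for a
  proof (rule Suc.IH[of "T - {t0}"])
    show "N < card (T - {t0})" using Suc.prems t0 by auto
    fix t assume t: "t \<in> T - {t0}"
    have "scale (t - t0) (\<Sum>a\<le>N. scale (t ^ a) (E a)) =
       (\<Sum>a<Suc N. \<Sum>k = Suc a..Suc N. scale ((t - t0) * (t0 ^ (k - Suc a) * t ^ a)) (D k))"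
      by (simp add: E_def scale_sum_right lessThan_Suc_atMost mult_ac del: sum.cl_ivl_Suc)
    also have "\<dots> = (\<Sum>k\<le>Suc N. \<Sum>a<k. scale ((t - t0) * (t0 ^ (k - Suc a) * t ^ a)) (D k))"
      by (rule sum.nested_swap'[symmetric])
    also have "\<dots> = (\<Sum>k\<le>Suc N. scale (t ^ k - t0 ^ k) (D k))"
      by (intro sum.cong refl)
        (simp add: scale_sum_left[symmetric] sum_distrib_left[symmetric] power_diff_sumr2)
    also have "\<dots> = (\<Sum>k\<le>Suc N. scale (t ^ k) (D k)) - (\<Sum>k\<le>Suc N. scale (t0 ^ k) (D k))"
      by (simp only: scale_left_diff_distrib sum_subtractf)
    also have "\<dots> \<in> S" using Suc.prems(3) t t0 S by (intro subspace_diff) auto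
    finally have "scale (t - t0) (\<Sum>a\<le>N. scale (t ^ a) (E a)) \<in> S" .
    from subspace_scale[OF S this, of "inverse (t - t0)"]
    show "(\<Sum>a\<le>N. scale (t ^ a) (E a)) \<in> S"
      using t unfolding scale_scale by simp
  qed (use Suc.prems a in auto)
  have D: "D (Suc a) \<in> S" if a: "a \<le> N" for a
  proof (cases "a = N")
    case True
    then show ?thesis using E[of N] by (simp add: E_def)
  next
    case False
    have "E a = D (Suc a) + (\<Sum>k = Suc (Suc a)..Suc N. scale (t0 ^ (k - Suc a)) (D k))"
      unfolding E_def using a by (subst sum.atLeast_Suc_atMost) auto
    also have "(\<Sum>k = Suc (Suc a)..Suc N. scale (t0 ^ (k - Suc a)) (D k)) = scale t0 (E (Suc a))"
      unfolding E_def scale_sum_right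
    proof (intro sum.cong refl)
      fix k assume "k \<in> {Suc (Suc a)..Suc N}"
      then have "k - Suc a = Suc (k - Suc (Suc a))" by auto
      then show "scale (t0 ^ (k - Suc a)) (D k) = scale t0 (scale (t0 ^ (k - Suc (Suc a))) (D k))" by simp
    qed
    finally have "D (Suc a) = E a - scale t0 (E (Suc a))" by simp
    also have "\<dots> \<in> S" using a False E S by (intro subspace_diff subspace_scale) auto
    finally show ?thesis .
  qed
  show ?case
  proof (cases k)
    case 0
    have "(\<Sum>k\<le>Suc N. scale (t0 ^ k) (D k)) = D 0 + (\<Sum>k\<le>N. scale (t0 ^ Suc k) (D (Suc k)))"
      by (subst sum.atMost_Suc_shift) simp
    then have "D 0 = (\<Sum>k\<le>Suc N. scale (t0 ^ k) (D k)) - (\<Sum>k\<le>N. scale (t0 ^ Suc k) (D (Suc k)))" by simp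
    also have "\<dots> \<in> S"
      by (rule subspace_diff[OF S Suc.prems(3)[OF t0] subspace_sum[OF S]])
        (use D S in \<open>auto intro: subspace_scale\<close>)
    finally show ?thesis using 0 by simp
  next
    case (Suc a)
    then show ?thesis using D Suc.prems(4) by simp
  qed
qed

section \<open>Powers of linear forms and base-\<open>p\<close> digits\<close>

lemma const2_eq_0_iff: "const2 c = 0 \<longleftrightarrow> c = 0"
  by (simp add: const2_def)

lemma CHAR_eq_CARD:
  assumes "Factorial_Ring.prime CARD('k::{field,finite})"
  shows "CHAR('k) = CARD('k)"
  using prime_nat_iff[THEN iffD1, OF assms] CHAR_dvd_CARD[where 'a = 'k] CHAR_not_1'[where 'a = 'k]
  by auto

lemma inj_on_of_nat_prime_field:
  assumes "Factorial_Ring.prime CARD('k::{field,finite})" "m < CARD('k)"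
  shows "inj_on (of_nat :: nat \<Rightarrow> 'k) {..m}"
  using assms(2) by (auto simp: inj_on_def of_nat_eq_iff_cong_CHAR CHAR_eq_CARD[OF assms(1)] cong_def)

lemma power_CARD_eq_self:
  fixes x :: "'k::{field,finite}"
  shows "x ^ CARD('k) = x"
proof (cases "x = 0")
  case False
  let ?P = "\<Prod>y\<in>UNIV - {0::'k}. y"
  have "?P = (\<Prod>y\<in>UNIV - {0}. x * y)"
    by (rule prod.reindex_bij_witness[of _ "\<lambda>y. x * y" "\<lambda>y. y / x"]) (use False in auto)
  also have "\<dots> = x ^ (CARD('k) - 1) * ?P"
    by (simp add: prod.distrib card_Diff_singleton)
  finally have "x ^ (CARD('k) - 1) = 1" by simp
  moreover have "CARD('k) = Suc (CARD('k) - 1)" by simp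
  ultimately show ?thesis by (metis mult.right_neutral power_Suc)
qed simp

lemma const2_power_CARD: "const2 (c::'k::{field,finite}) ^ CARD('k) = const2 c"
  by (simp flip: const2_power add: power_CARD_eq_self)

lemma form_frobenius:
  fixes f :: "'a \<Rightarrow> 'k::{field,finite} poly poly"
  assumes "Factorial_Ring.prime CARD('k)"
  shows "sum f A ^ CARD('k) = (\<Sum>x\<in>A. f x ^ CARD('k))"
  using assms by (intro freshmans_dream_sum) (simp_all add: CHAR_eq_CARD)

lemma coeff_power_CARD:
  fixes H :: "'k::{field,finite} poly poly"
  assumes pr: "Factorial_Ring.prime CARD('k)"
  shows "coeff (H ^ CARD('k)) e =
    (if CARD('k) dvd e then coeff H (e div CARD('k)) ^ CARD('k) else 0)"
proof -
  let ?p = "CARD('k)"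
  have p: "?p > 0" by simp
  have "H ^ ?p = (\<Sum>k\<le>degree H. monom (coeff H k) k) ^ ?p"
    by (simp only: poly_as_sum_of_monoms)
  also have "\<dots> = (\<Sum>k\<le>degree H. monom (coeff H k ^ ?p) (k * ?p))"
    by (simp only: form_frobenius[OF pr] monom_power)
  finally have "coeff (H ^ ?p) e = (\<Sum>k\<le>degree H. if k * ?p = e then coeff H k ^ ?p else 0)"
    by (simp add: coeff_sum)
  also have "\<dots> = (\<Sum>k\<le>degree H. if k = e div ?p then if ?p dvd e then coeff H k ^ ?p else 0 else 0)"
    using p by (intro sum.cong) auto
  also have "\<dots> = (if ?p dvd e then coeff H (e div ?p) ^ ?p else 0)"
    using p by (auto simp: coeff_eq_0 not_le power_0_left)
  finally show ?thesis .
qed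

text \<open>
  The exponents of \<open>Y\<close> occurring in a \<open>p\<close>-th power are multiples of \<open>p\<close>, so the summands have exponents
  of \<open>Y\<close> in different residue classes modulo \<open>p\<close> and cannot cancel.
\<close>

lemma monomials_independent_over_frobenius:
  fixes H :: "nat \<Rightarrow> 'k::{field,finite} poly poly"
  assumes pr: "Factorial_Ring.prime CARD('k)" and N: "N < CARD('k)"
    and zero: "(\<Sum>c\<le>N. varX ^ c * varY ^ (N - c) * H c ^ CARD('k)) = 0" and c: "c \<le> N"
  shows "H c = 0"
proof (rule poly_eqI)
  fix e
  let ?p = "CARD('k)"
  let ?m = "N - c + e * ?p"
  have Y: "varY ^ b = monom (1 :: 'k poly) b" for b by (simp add: varY_def monom_altdef)
  have X: "varX ^ b * F = Polynomial.smult ([:0, 1:] ^ b) F" for b and F :: "'k poly poly"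
    by (simp add: varX_def poly_const_pow)
  have t: "coeff (varX ^ c' * varY ^ (N - c') * H c' ^ ?p) ?m =
      (if c' = c then [:0, 1:] ^ c * coeff (H c) e ^ ?p else 0)" if c': "c' \<le> N" for c'
  proof (cases "c' = c")
    case True
    then show ?thesis
      by (simp add: mult.assoc X Y coeff_monom_mult coeff_power_CARD[OF pr])
  next
    case False
    have "\<not> ?p dvd ?m - (N - c')" if "\<not> ?m < N - c'"
    proof
      assume "?p dvd ?m - (N - c')"
      then have "[?m = N - c'] (mod ?p)"
        using that by (metis cong_altdef_nat not_less)
      then have "(N - c) mod ?p = (N - c') mod ?p" by (simp add: cong_def)
      then have "N - c = N - c'" using N by simp
      then show False using False c c' by simp
    qed
    then show ?thesis using False
      by (simp add: mult.assoc X Y coeff_monom_mult coeff_power_CARD[OF pr])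
  qed
  have "0 = coeff (\<Sum>c\<le>N. varX ^ c * varY ^ (N - c) * H c ^ ?p) ?m" by (simp add: zero)
  also have "\<dots> = (\<Sum>c'\<le>N. if c' = c then [:0, 1:] ^ c * coeff (H c) e ^ ?p else 0)"
    unfolding coeff_sum by (intro sum.cong refl t) auto
  also have "\<dots> = [:0, 1:] ^ c * coeff (H c) e ^ ?p" using c by simp
  finally show "coeff (H c) e = coeff 0 e" by simp
qed

lemma digit_sum_rec:
  assumes "p \<ge> 2"
  shows "digit_sum p n = n mod p + digit_sum p (n div p)"
proof (cases "n = 0")
  case True
  then show ?thesis by (simp add: digit_sum_def)
next
  case False
  have "digit_sum p n = (\<Sum>k<Suc n. n div p ^ k mod p)"
    by (simp add: digit_sum_def lessThan_Suc_atMost)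
  also have "\<dots> = n mod p + (\<Sum>k<n. n div p div p ^ k mod p)"
    by (subst sum.lessThan_Suc_shift) (simp add: div_mult2_eq)
  also have "(\<Sum>k<n. n div p div p ^ k mod p) = (\<Sum>k\<le>n div p. n div p div p ^ k mod p)"
  proof (intro sum.mono_neutral_right ballI)
    have "n div p < n" using assms False by simp
    then show "{..n div p} \<subseteq> {..<n}" by auto
    fix k assume "k \<in> {..<n} - {..n div p}"
    then have "n div p < k" by auto
    also have "k < p ^ k" using assms by (simp add: power_gt_expt)
    finally show "n div p div p ^ k mod p = 0" by simp
  qed auto
  finally show ?thesis by (simp add: digit_sum_def)
qed

lemma sum_over_antidiagonals:
  fixes g :: "nat \<Rightarrow> nat \<Rightarrow> 'a::comm_semiring_0"
  shows "(\<Sum>c\<le>d + i. h c * (\<Sum>l\<le>d. \<Sum>k\<le>i. if l + k = c then g l k else 0)) =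
    (\<Sum>l\<le>d. \<Sum>k\<le>i. h (l + k) * g l k)"
proof -
  have "(\<Sum>c\<le>d + i. h c * (\<Sum>l\<le>d. \<Sum>k\<le>i. if l + k = c then g l k else 0)) =
    (\<Sum>c\<le>d + i. \<Sum>l\<le>d. \<Sum>k\<le>i. if l + k = c then h c * g l k else 0)"
    unfolding sum_distrib_left by (intro sum.cong refl) simp
  also have "\<dots> = (\<Sum>l\<le>d. \<Sum>c\<le>d + i. \<Sum>k\<le>i. if l + k = c then h c * g l k else 0)"
    by (rule sum.swap)
  also have "\<dots> = (\<Sum>l\<le>d. \<Sum>k\<le>i. \<Sum>c\<le>d + i. if l + k = c then h c * g l k else 0)"
    by (rule sum.cong[OF refl sum.swap])
  also have "\<dots> = (\<Sum>l\<le>d. \<Sum>k\<le>i. h (l + k) * g l k)"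
    by (intro sum.cong refl) auto
  finally show ?thesis .
qed

text \<open>
  If the \<open>\<epsilon> b\<close> are the coefficients of the powers \<open>L\<^sub>v\<^sup>m\<close>, these are the coefficients of
  \<open>L\<^sub>v\<^bsup>d + pm\<^esup>\<close>, obtained by multiplying the binomial expansion of \<open>L\<^sub>v\<^sup>d\<close> with the \<open>p\<close>-th power.
\<close>

definition adjoin_digit ::
    "nat \<Rightarrow> nat \<Rightarrow> (nat \<Rightarrow> 'k::{field,finite} poly poly) \<Rightarrow> nat \<Rightarrow> 'k poly poly"
  where "adjoin_digit d s \<epsilon> j = (\<Sum>l\<le>d. \<Sum>b\<le>s. if l + b = j
    then const2 (of_nat (d choose l)) * (varX ^ l * varY ^ (d - l)) * \<epsilon> b ^ CARD('k) else 0)"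

lemma sum_adjoin_digit:
  fixes \<epsilon> :: "nat \<Rightarrow> 'k::{field,finite} poly poly"
  assumes pr: "Factorial_Ring.prime CARD('k)"
  shows "(\<Sum>j\<le>d + s. const2 (f j) * adjoin_digit d s \<epsilon> j) = (\<Sum>l\<le>d. varX ^ l * varY ^ (d - l) *
    (\<Sum>b\<le>s. const2 (of_nat (d choose l) * f (l + b)) * \<epsilon> b) ^ CARD('k))"
proof -
  have "(\<Sum>j\<le>d + s. const2 (f j) * adjoin_digit d s \<epsilon> j) = (\<Sum>l\<le>d. \<Sum>b\<le>s. const2 (f (l + b)) *
      (const2 (of_nat (d choose l)) * (varX ^ l * varY ^ (d - l)) * \<epsilon> b ^ CARD('k)))"
    unfolding adjoin_digit_def by (rule sum_over_antidiagonals)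
  also have "\<dots> = (\<Sum>l\<le>d. varX ^ l * varY ^ (d - l) *
    (\<Sum>b\<le>s. const2 (of_nat (d choose l) * f (l + b)) * \<epsilon> b) ^ CARD('k))"
    unfolding form_frobenius[OF pr] sum_distrib_left power_mult_distrib const2_power_CARD
    by (intro sum.cong refl) (simp only: const2_hom mult_ac)
  finally show ?thesis .
qed

text \<open>
  The second part is the linear independence of \<open>\<epsilon> 0, \<dots>, \<epsilon> (S n)\<close>. The number of coefficients
  is governed by the digit sum because \<open>t\<^sup>p = t\<close> in the field: only the sum of the digits of an exponent
  matters.
\<close>

definition digit_basis :: "nat \<Rightarrow> (nat \<Rightarrow> 'k::{field,finite} poly poly) \<Rightarrow> bool"
  where "digit_basis n \<epsilon> \<longleftrightarrow>
    (\<forall>v. linform v ^ n = (\<Sum>j\<le>digit_sum CARD('k) n.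
      const2 (v $ 1 ^ j * v $ 2 ^ (digit_sum CARD('k) n - j)) * \<epsilon> j)) \<and>
    (\<forall>\<beta>. (\<Sum>j\<le>digit_sum CARD('k) n. const2 (\<beta> j) * \<epsilon> j) = 0 \<longrightarrow>
      (\<forall>j\<le>digit_sum CARD('k) n. \<beta> j = 0))"

lemma digit_basis_independent:
  assumes "digit_basis n \<epsilon>" "(\<Sum>j\<le>digit_sum CARD('k) n. const2 (\<beta> j) * \<epsilon> j) = (0 :: 'k poly poly)"
    and "j \<le> digit_sum CARD('k::{field,finite}) n"
  shows "\<beta> j = 0"
  using assms unfolding digit_basis_def by blast

lemma binomial_not_0_below_CARD:
  assumes pr: "Factorial_Ring.prime CARD('k::{field,finite})" and "d < CARD('k)" "l \<le> d"
  shows "of_nat (d choose l) \<noteq> (0::'k)"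
proof
  assume "of_nat (d choose l) = (0::'k)"
  then have "CARD('k) dvd d choose l" by (simp add: of_nat_eq_0_iff_char_dvd CHAR_eq_CARD[OF pr])
  also have "d choose l dvd fact d" using assms(3)
    by (metis binomial_fact_lemma dvd_triv_right)
  finally show False using assms(2) pr by (simp add: prime_dvd_fact_iff)
qed

text \<open>
  A relation between the new coefficients decomposes, by independence of monomials over \<open>p\<close>-th powers,
  into relations between the old ones, one for each \<open>l \<le> d\<close>; they involve the coefficient \<open>\<beta> j\<close> as
  soon as \<open>j - l\<close> is an admissible index, and its factor \<open>d choose l\<close> is a unit.
\<close>

lemma digit_basis_adjoin_digit:
  fixes \<epsilon> :: "nat \<Rightarrow> 'k::{field,finite} poly poly"
  assumes pr: "Factorial_Ring.prime CARD('k)" and d: "d < CARD('k)" and \<epsilon>: "digit_basis m \<epsilon>"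
  shows "digit_basis (d + CARD('k) * m) (adjoin_digit d (digit_sum CARD('k) m) \<epsilon>)"
proof -
  let ?p = "CARD('k)"
  define s where "s = digit_sum ?p m"
  have "?p \<ge> 2" using pr by (rule prime_ge_2_nat)
  then have s: "digit_sum ?p (d + ?p * m) = d + s"
    using d by (subst digit_sum_rec) (simp_all add: s_def)
  have 1: "linform v ^ (d + ?p * m) =
      (\<Sum>j\<le>d + s. const2 (v $ 1 ^ j * v $ 2 ^ (d + s - j)) * adjoin_digit d s \<epsilon> j)" for v
  proof -
    have "linform v ^ (d + ?p * m) = linform v ^ d * (linform v ^ m) ^ ?p"
      by (simp add: power_add mult.commute flip: power_mult)
    also have "linform v ^ d = (\<Sum>l\<le>d. const2 (of_nat (d choose l) * v $ 1 ^ l * v $ 2 ^ (d - l)) *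
        (varX ^ l * varY ^ (d - l)))"
      unfolding linform_def binomial_ring
      by (simp only: const2_hom const2_power const2_of_nat power_mult_distrib mult_ac)
    also have "(linform v ^ m) ^ ?p = (\<Sum>b\<le>s. const2 (v $ 1 ^ b * v $ 2 ^ (s - b)) * \<epsilon> b) ^ ?p"
      using \<epsilon> by (simp add: digit_basis_def s_def)
    finally have "linform v ^ (d + ?p * m) = (\<Sum>l\<le>d. \<Sum>b\<le>s.
        const2 (of_nat (d choose l) * v $ 1 ^ l * v $ 2 ^ (d - l)) * (varX ^ l * varY ^ (d - l)) *
        (const2 (v $ 1 ^ b * v $ 2 ^ (s - b)) * \<epsilon> b ^ ?p))"
      unfolding form_frobenius[OF pr] sum_product power_mult_distrib const2_power_CARD .
    also have "\<dots> = (\<Sum>j\<le>d + s. const2 (v $ 1 ^ j * v $ 2 ^ (d + s - j)) * adjoin_digit d s \<epsilon> j)"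
      unfolding sum_adjoin_digit[OF pr] form_frobenius[OF pr] sum_distrib_left
        power_mult_distrib const2_power_CARD
    proof (intro sum.cong refl)
      fix l b assume "l \<in> {..d}" "b \<in> {..s}"
      then have e: "d + s - (l + b) = (d - l) + (s - b)" by auto
      show "const2 (of_nat (d choose l) * v $ 1 ^ l * v $ 2 ^ (d - l)) * (varX ^ l * varY ^ (d - l)) *
          (const2 (v $ 1 ^ b * v $ 2 ^ (s - b)) * \<epsilon> b ^ ?p) =
        varX ^ l * varY ^ (d - l) * (const2 (of_nat (d choose l) *
          (v $ 1 ^ (l + b) * v $ 2 ^ (d + s - (l + b)))) * \<epsilon> b ^ ?p)"
        unfolding e by (simp only: const2_hom power_add mult_ac)
    qed
    finally show ?thesis .
  qed
  have 2: "\<beta> j = 0" if zero: "(\<Sum>j\<le>d + s. const2 (\<beta> j) * adjoin_digit d s \<epsilon> j) = 0" and j: "j \<le> d + s"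
    for \<beta> j
  proof -
      \<comment> \<open>any \<open>l \<le> d\<close> with \<open>0 \<le> j - l \<le> s\<close> would do\<close>
    define l where "l = min d j"
    have l: "l \<le> d" "j - l \<le> s" "l + (j - l) = j" using j by (auto simp: l_def)
    have "(\<Sum>b\<le>s. const2 (of_nat (d choose l) * \<beta> (l + b)) * \<epsilon> b) = 0"
      using zero unfolding sum_adjoin_digit[OF pr]
      by (rule monomials_independent_over_frobenius[OF pr d _ l(1)])
    then have "of_nat (d choose l) * \<beta> (l + (j - l)) = 0"
      unfolding s_def by (rule digit_basis_independent[OF \<epsilon>]) (use l(2) in \<open>simp add: s_def\<close>)
    then show ?thesis using binomial_not_0_below_CARD[OF pr d l(1)] l(3) by simp
  qed
  show ?thesis using 1 2 unfolding digit_basis_def s s_def[symmetric] by blast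
qed

lemma digit_basis_exists:
  assumes pr: "Factorial_Ring.prime CARD('k::{field,finite})"
  obtains \<epsilon> :: "nat \<Rightarrow> 'k::{field,finite} poly poly" where "digit_basis n \<epsilon>"
proof -
  have "\<exists>\<epsilon> :: nat \<Rightarrow> 'k poly poly. digit_basis n \<epsilon>"
  proof (induction n rule: less_induct)
    case (less n)
    show ?case
    proof (cases "n = 0")
      case True
      have "digit_sum CARD('k) 0 = 0" by (simp add: digit_sum_def)
      then have "digit_basis 0 (\<lambda>_. 1 :: 'k poly poly)"
        by (simp add: digit_basis_def const2_hom const2_eq_0_iff)
      then show ?thesis using True by blast
    next
      case False
      have p: "CARD('k) \<ge> 2" using pr by (rule prime_ge_2_nat)
      then obtain \<epsilon> :: "nat \<Rightarrow> 'k poly poly" where "digit_basis (n div CARD('k)) \<epsilon>"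
        using less[of "n div CARD('k)"] False by auto
      from digit_basis_adjoin_digit[OF pr _ this, of "n mod CARD('k)"] show ?thesis
        using p by auto
    qed
  qed
  then show thesis using that by blast
qed

text \<open>
  Both the injectivity of multiplication and the coincidence of the modules \<open>X\<^bsub>r-i,r\<^esub>\<close> for \<open>i \<ge> s\<close> are
  read off from this identity: in terms of the independent products \<open>X\<^sup>c Y\<^bsup>d+i-c\<^esup> \<epsilon>\<^sub>b\<^sup>p\<close>, the
  multiplication map is the linear system with binomial coefficients studied above.
\<close>

lemma product_expansion:
  fixes \<epsilon> :: "nat \<Rightarrow> 'k::{field,finite} poly poly"
  assumes pr: "Factorial_Ring.prime CARD('k)"
  shows "(\<Sum>k\<le>i. (\<Sum>j\<le>d + s. const2 (a j k) * adjoin_digit d s \<epsilon> j) * (varX ^ k * varY ^ (i - k))) =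
    (\<Sum>c\<le>d + i. varX ^ c * varY ^ (d + i - c) * (\<Sum>b\<le>s. const2
      (\<Sum>l\<le>d. \<Sum>k\<le>i. if l + k = c then of_nat (d choose l) * a (l + b) k else 0) * \<epsilon> b) ^ CARD('k))"
proof -
  define G where "G l k = (\<Sum>b\<le>s. const2 (of_nat (d choose l) * a (l + b) k) * \<epsilon> b)" for l k
  have G: "(\<Sum>b\<le>s. const2 (\<Sum>l\<le>d. \<Sum>k\<le>i. if l + k = c then of_nat (d choose l) * a (l + b) k else 0)
      * \<epsilon> b) ^ CARD('k) = (\<Sum>l\<le>d. \<Sum>k\<le>i. if l + k = c then G l k ^ CARD('k) else 0)" for c
  proof -
    have "(\<Sum>b\<le>s. const2 (\<Sum>l\<le>d. \<Sum>k\<le>i. if l + k = c then of_nat (d choose l) * a (l + b) k else 0)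
        * \<epsilon> b) = (\<Sum>b\<le>s. \<Sum>l\<le>d. \<Sum>k\<le>i. if l + k = c then
          const2 (of_nat (d choose l) * a (l + b) k) * \<epsilon> b else 0)"
      unfolding const2_sum sum_distrib_right by (intro sum.cong refl) (simp add: const2_hom)
    also have "\<dots> = (\<Sum>l\<le>d. \<Sum>b\<le>s. \<Sum>k\<le>i. if l + k = c then
          const2 (of_nat (d choose l) * a (l + b) k) * \<epsilon> b else 0)"
      by (rule sum.swap)
    also have "\<dots> = (\<Sum>l\<le>d. \<Sum>k\<le>i. \<Sum>b\<le>s. if l + k = c then
          const2 (of_nat (d choose l) * a (l + b) k) * \<epsilon> b else 0)"
      by (rule sum.cong[OF refl sum.swap])
    also have "\<dots> = (\<Sum>l\<le>d. \<Sum>k\<le>i. if l + k = c then G l k else 0)"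
      by (intro sum.cong refl) (simp add: G_def)
    finally show ?thesis
      by (simp only: form_frobenius[OF pr]) (intro sum.cong refl, simp)
  qed
  have "(\<Sum>k\<le>i. (\<Sum>j\<le>d + s. const2 (a j k) * adjoin_digit d s \<epsilon> j) * (varX ^ k * varY ^ (i - k))) =
     (\<Sum>k\<le>i. \<Sum>l\<le>d. (varX ^ l * varY ^ (d - l) * G l k ^ CARD('k)) * (varX ^ k * varY ^ (i - k)))"
    unfolding sum_adjoin_digit[OF pr] G_def sum_distrib_right ..
  also have "\<dots> = (\<Sum>l\<le>d. \<Sum>k\<le>i. (varX ^ l * varY ^ (d - l) * G l k ^ CARD('k)) *
      (varX ^ k * varY ^ (i - k)))"
    by (rule sum.swap)
  also have "\<dots> = (\<Sum>l\<le>d. \<Sum>k\<le>i. varX ^ (l + k) * varY ^ (d + i - (l + k)) * G l k ^ CARD('k))"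
  proof (intro sum.cong refl)
    fix l k assume "l \<in> {..d}" "k \<in> {..i}"
    then have "d + i - (l + k) = (d - l) + (i - k)" by auto
    then show "(varX ^ l * varY ^ (d - l) * G l k ^ CARD('k)) * (varX ^ k * varY ^ (i - k)) =
        varX ^ (l + k) * varY ^ (d + i - (l + k)) * G l k ^ CARD('k)"
      by (simp only: power_add mult_ac)
  qed
  also have "\<dots> = (\<Sum>c\<le>d + i. varX ^ c * varY ^ (d + i - c) *
      (\<Sum>l\<le>d. \<Sum>k\<le>i. if l + k = c then G l k ^ CARD('k) else 0))"
    by (rule sum_over_antidiagonals[symmetric])
  finally show ?thesis unfolding G .
qed

section \<open>Isomorphisms onto quotient modules\<close>


lemma ring_of_type_algebra_simps [simp]:
  "carrier (field_ring :: 'k::field ring) = UNIV"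
  "x \<oplus>\<^bsub>(field_ring :: 'k ring)\<^esub> y = x + y" "x \<otimes>\<^bsub>(field_ring :: 'k ring)\<^esub> y = x * y"
  "\<one>\<^bsub>(field_ring :: 'k ring)\<^esub> = 1" "\<zero>\<^bsub>(field_ring :: 'k ring)\<^esub> = 0"
  by (simp_all add: ring_of_type_algebra_def)

lemma forms_on_simps [simp]:
  "carrier (forms_on S) = S" "x \<oplus>\<^bsub>forms_on S\<^esub> y = x + y" "\<zero>\<^bsub>forms_on S\<^esub> = 0"
  "c \<odot>\<^bsub>forms_on S\<^esub> x = const2 c * x" "act (forms_on S) = form_act"
  by (simp_all add: forms_on_def)

lemma forms_on_module:
  assumes "forms.subspace S"
  shows "Module.module field_ring (forms_on S)"
proof (rule moduleI)
  show "cring (field_ring :: 'a ring)" by (rule cring_from_type_algebra)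
  show "abelian_group (forms_on S)"
  proof (rule abelian_groupI)
    fix x assume "x \<in> carrier (forms_on S)"
    then show "\<exists>y\<in>carrier (forms_on S). y \<oplus>\<^bsub>forms_on S\<^esub> x = \<zero>\<^bsub>forms_on S\<^esub>"
      using assms by (intro bexI[of _ "- x"]) (simp_all add: forms.subspace_neg)
  qed (simp_all add: assms forms.subspace_add forms.subspace_0 add_ac)
qed (simp_all add: assms forms.subspace_scale const2_hom distrib_left distrib_right mult.assoc)

lemma forms_on_mat2_module:
  assumes "forms.subspace S" "\<And>g F. F \<in> S \<Longrightarrow> form_act g F \<in> S"
  shows "is_mat2_module (forms_on S)"
  using assms forms_on_module[OF assms(1)]
  by (simp add: is_mat2_module_def form_act_hom form_act_one form_act_mult)

text \<open>
  Transport of structure: the right-hand side inherits the module axioms along \<open>\<phi>\<close>, so for tensor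
  products they are obtained without computing with cosets.
\<close>

lemma mat2_isomorphic_transport:
  assumes U: "is_mat2_module U" and bij: "bij_betw \<phi> (carrier U) (carrier Q)"
    and zero: "\<phi> \<zero>\<^bsub>U\<^esub> = \<zero>\<^bsub>Q\<^esub>"
    and add: "\<And>x y. x \<in> carrier U \<Longrightarrow> y \<in> carrier U \<Longrightarrow> \<phi> (x \<oplus>\<^bsub>U\<^esub> y) = \<phi> x \<oplus>\<^bsub>Q\<^esub> \<phi> y"
    and smult: "\<And>c x. x \<in> carrier U \<Longrightarrow> \<phi> (c \<odot>\<^bsub>U\<^esub> x) = c \<odot>\<^bsub>Q\<^esub> \<phi> x"
    and act: "\<And>g x. x \<in> carrier U \<Longrightarrow> \<phi> (act U g x) = act Q g (\<phi> x)"
  shows "U \<cong>\<^sub>M Q"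
proof -
  have mod: "Module.module field_ring U"
    and act_closed: "\<And>g x. x \<in> carrier U \<Longrightarrow> act U g x \<in> carrier U"
    and act_add: "\<And>g x y. x \<in> carrier U \<Longrightarrow> y \<in> carrier U \<Longrightarrow>
      act U g (x \<oplus>\<^bsub>U\<^esub> y) = act U g x \<oplus>\<^bsub>U\<^esub> act U g y"
    and act_smult: "\<And>g c x. x \<in> carrier U \<Longrightarrow> act U g (c \<odot>\<^bsub>U\<^esub> x) = c \<odot>\<^bsub>U\<^esub> act U g x"
    and act_one: "\<And>x. x \<in> carrier U \<Longrightarrow> act U (mat 1) x = x"
    and act_mult: "\<And>g h x. x \<in> carrier U \<Longrightarrow> act U (g ** h) x = act U g (act U h x)"
    using U by (auto simp: is_mat2_module_def)
  interpret U: Module.module field_ring U by (rule mod)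
  have Q: "\<And>x. x \<in> carrier U \<Longrightarrow> \<phi> x \<in> carrier Q" using bij by (auto simp: bij_betw_def)
  have carrier_Q: "carrier Q = \<phi> ` carrier U" using bij by (simp add: bij_betw_def)
  have "abelian_group Q"
  proof (rule abelian_groupI)
    fix q assume "q \<in> carrier Q"
    then obtain x where x: "x \<in> carrier U" "q = \<phi> x" using carrier_Q by blast
    then have "\<phi> (\<ominus>\<^bsub>U\<^esub> x) \<oplus>\<^bsub>Q\<^esub> q = \<zero>\<^bsub>Q\<^esub>"
      by (simp add: U.l_neg flip: add zero)
    then show "\<exists>y\<in>carrier Q. y \<oplus>\<^bsub>Q\<^esub> q = \<zero>\<^bsub>Q\<^esub>" using Q x by blast
  qed (auto simp: carrier_Q U.a_ac simp flip: add zero)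
  then have "Module.module field_ring Q"
    by (intro moduleI) (auto simp: carrier_Q U.smult_r_distr U.is_cring
        U.smult_l_distr[simplified] U.smult_assoc1[simplified] U.smult_one[simplified]
        simp flip: add smult)
  then have "is_mat2_module Q"
    unfolding is_mat2_module_def
    by (auto simp: carrier_Q act_closed act_add act_smult act_one act_mult
        simp flip: add smult act)
  moreover have "\<phi> \<in> iso (add_monoid U) (add_monoid Q)"
    using bij Q add by (auto simp: iso_def hom_def)
  ultimately show ?thesis
    using U smult act unfolding mat2_isomorphic_def by blast
qed

text \<open>
  The cosets of the kernel are the fibres of \<open>\<Phi>\<close>, so \<open>z \<mapsto> {x. \<Phi> x = z}\<close> is the inverse of the map
  induced by \<open>\<Phi>\<close>.
\<close>

lemma quotient_by_kernel:
  assumes V: "Module.module field_ring V" and U: "is_mat2_module U"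
    and act_closed: "\<And>g x. x \<in> carrier V \<Longrightarrow> act V g x \<in> carrier V"
    and surj: "\<Phi> ` carrier V = carrier U"
    and add: "\<And>x y. x \<in> carrier V \<Longrightarrow> y \<in> carrier V \<Longrightarrow> \<Phi> (x \<oplus>\<^bsub>V\<^esub> y) = \<Phi> x \<oplus>\<^bsub>U\<^esub> \<Phi> y"
    and smult: "\<And>c x. x \<in> carrier V \<Longrightarrow> \<Phi> (c \<odot>\<^bsub>V\<^esub> x) = c \<odot>\<^bsub>U\<^esub> \<Phi> x"
    and act: "\<And>g x. x \<in> carrier V \<Longrightarrow> \<Phi> (act V g x) = act U g (\<Phi> x)"
  shows "U \<cong>\<^sub>M quotient_module V {x \<in> carrier V. \<Phi> x = \<zero>\<^bsub>U\<^esub>}"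
proof -
  interpret V: Module.module field_ring V by (rule V)
  have "Module.module field_ring U" using U by (simp add: is_mat2_module_def)
  then interpret U: Module.module field_ring U .
  define N where "N = {x \<in> carrier V. \<Phi> x = \<zero>\<^bsub>U\<^esub>}"
  define \<phi> where "\<phi> z = {x \<in> carrier V. \<Phi> x = z}" for z
  have \<Phi>: "\<Phi> x \<in> carrier U" if "x \<in> carrier V" for x using surj that by blast
  have minus_add: "x \<in> carrier V \<Longrightarrow> y \<in> carrier V \<Longrightarrow> y = (y \<ominus>\<^bsub>V\<^esub> x) \<oplus>\<^bsub>V\<^esub> x" for x y
    by (simp add: V.minus_eq V.a_assoc V.l_neg)
  have \<Phi>_minus: "\<Phi> (y \<ominus>\<^bsub>V\<^esub> x) \<oplus>\<^bsub>U\<^esub> \<Phi> x = \<Phi> y" if "x \<in> carrier V" "y \<in> carrier V" for x y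
    using add[of "y \<ominus>\<^bsub>V\<^esub> x" x] minus_add[OF that] that by simp
  have coset: "N +>\<^bsub>V\<^esub> x = \<phi> (\<Phi> x)" if x: "x \<in> carrier V" for x
  proof (intro Set.set_eqI iffI)
    fix y assume "y \<in> N +>\<^bsub>V\<^esub> x"
    then show "y \<in> \<phi> (\<Phi> x)"
      using x by (auto simp: a_r_coset_def' N_def \<phi>_def add \<Phi>)
  next
    fix y assume y: "y \<in> \<phi> (\<Phi> x)"
    then have yV: "y \<in> carrier V" "\<Phi> y = \<Phi> x" by (simp_all add: \<phi>_def)
    have "\<Phi> (y \<ominus>\<^bsub>V\<^esub> x) = \<zero>\<^bsub>U\<^esub>"
      using x yV \<Phi>_minus[OF x yV(1)] \<Phi> by (metis U.zero_closed V.minus_closed U.l_zero U.add.right_cancel)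
    moreover note minus_add[OF x yV(1)]
    ultimately show "y \<in> N +>\<^bsub>V\<^esub> x"
      using x yV by (auto simp: a_r_coset_def' N_def)
  qed
  have ne: "\<exists>x\<in>carrier V. \<Phi> x = z" if "z \<in> carrier U" for z using surj that by (metis imageE)
  have "carrier (quotient_module V N) = (\<lambda>x. N +>\<^bsub>V\<^esub> x) ` carrier V"
    by (auto simp: quotient_module_def A_RCOSETS_def')
  also have "\<dots> = \<phi> ` \<Phi> ` carrier V"
    unfolding image_image by (intro image_cong refl coset)
  finally have carrier: "carrier (quotient_module V N) = \<phi> ` carrier U"
    by (simp only: surj)
  have inj: "inj_on \<phi> (carrier U)"
    using ne by (intro inj_onI) (auto simp: \<phi>_def)
  have Un: "(\<Union>x\<in>\<phi> z. N +>\<^bsub>V\<^esub> h x) = \<phi> (H z)"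
    if z: "z \<in> carrier U" and h: "\<And>x. x \<in> carrier V \<Longrightarrow> h x \<in> carrier V \<and> \<Phi> (h x) = H (\<Phi> x)"
    for z h H
  proof -
    have "N +>\<^bsub>V\<^esub> h x = \<phi> (H z)" if "x \<in> \<phi> z" for x
      using that h[of x] coset[of "h x"] by (simp add: \<phi>_def)
    moreover have "\<phi> z \<noteq> {}" using ne[OF z] by (auto simp: \<phi>_def)
    ultimately show ?thesis by simp
  qed
  have "U \<cong>\<^sub>M quotient_module V N"
  proof (rule mat2_isomorphic_transport[OF U, where \<phi> = \<phi>])
    show "bij_betw \<phi> (carrier U) (carrier (quotient_module V N))"
      using inj carrier by (simp add: bij_betw_def)
    show "\<phi> \<zero>\<^bsub>U\<^esub> = \<zero>\<^bsub>quotient_module V N\<^esub>"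
      by (simp add: quotient_module_def \<phi>_def N_def)
  next
    fix y z assume y: "y \<in> carrier U" and z: "z \<in> carrier U"
    have "w \<in> \<phi> y <+>\<^bsub>V\<^esub> \<phi> z" if w: "w \<in> \<phi> (y \<oplus>\<^bsub>U\<^esub> z)" for w
    proof -
      obtain x where x: "x \<in> carrier V" "\<Phi> x = z" using ne z by blast
      have wV: "w \<in> carrier V" "\<Phi> w = y \<oplus>\<^bsub>U\<^esub> z" using w by (simp_all add: \<phi>_def)
      have "\<Phi> (w \<ominus>\<^bsub>V\<^esub> x) = y"
        using x wV \<Phi>_minus[OF x(1) wV(1)] \<Phi> y z by (metis V.minus_closed U.add.right_cancel)
      moreover note minus_add[OF x(1) wV(1)]
      ultimately show ?thesis
        using x wV by (auto simp: set_add_def' \<phi>_def)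
    qed
    then show "\<phi> (y \<oplus>\<^bsub>U\<^esub> z) = \<phi> y \<oplus>\<^bsub>quotient_module V N\<^esub> \<phi> z"
      by (auto simp: quotient_module_def set_add_def' \<phi>_def add)
  next
    fix c z assume "z \<in> carrier U"
    then show "\<phi> (c \<odot>\<^bsub>U\<^esub> z) = c \<odot>\<^bsub>quotient_module V N\<^esub> \<phi> z"
      using Un[of z "\<lambda>x. c \<odot>\<^bsub>V\<^esub> x" "\<lambda>z. c \<odot>\<^bsub>U\<^esub> z"] smult V.smult_closed
      by (simp add: quotient_module_def)
  next
    fix g z assume "z \<in> carrier U"
    then show "\<phi> (act U g z) = act (quotient_module V N) g (\<phi> z)"
      using Un[of z "act V g" "act U g"] act act_closed
      by (simp add: quotient_module_def)
  qed
  then show ?thesis by (simp only: N_def)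
qed

section \<open>Tensor products of spaces of forms\<close>

lemma lookup_map_mult: "Poly_Mapping.lookup (Poly_Mapping.map ((*) c) f) u = c * Poly_Mapping.lookup f u"
  for c :: "'k::field"
  by (simp add: Poly_Mapping.map.rep_eq when_def)

lemma free_module_simps [simp]:
  "carrier (free_module V W) = {f. Poly_Mapping.keys f \<subseteq> carrier V \<times> carrier W}"
  "f \<oplus>\<^bsub>free_module V W\<^esub> g = f + g" "\<zero>\<^bsub>free_module V W\<^esub> = 0"
  "c \<odot>\<^bsub>free_module V W\<^esub> f = Poly_Mapping.map ((*) c) f"
  by (simp_all add: free_module_def)

lemma keys_map_mult: "Poly_Mapping.keys (Poly_Mapping.map ((*) c) f) \<subseteq> Poly_Mapping.keys f"
  for c :: "'k::field"
  by (auto simp: in_keys_iff lookup_map_mult)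

lemma free_module_module: "Module.module field_ring (free_module V W)"
proof (rule moduleI)
  show "cring (field_ring :: 'a ring)" by (rule cring_from_type_algebra)
  show "abelian_group (free_module V W)"
  proof (rule abelian_groupI)
    fix f assume "f \<in> carrier (free_module V W)"
    then show "\<exists>g\<in>carrier (free_module V W). g \<oplus>\<^bsub>free_module V W\<^esub> f = \<zero>\<^bsub>free_module V W\<^esub>"
      by (intro bexI[of _ "- f"]) (simp_all add: in_keys_iff subset_iff)
  next
    fix f g assume "f \<in> carrier (free_module V W)" "g \<in> carrier (free_module V W)"
    then show "f \<oplus>\<^bsub>free_module V W\<^esub> g \<in> carrier (free_module V W)"
      using keys_add[of f g] by auto
  qed (simp_all add: add_ac)
next
  fix c :: 'a and f assume "f \<in> carrier (free_module V W)"
  then show "c \<odot>\<^bsub>free_module V W\<^esub> f \<in> carrier (free_module V W)"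
    using keys_map_mult[of c f] by auto
qed (auto intro!: poly_mapping_eqI simp: lookup_map_mult lookup_add algebra_simps)

text \<open>
  The linear extension of \<open>(F, G) \<mapsto> F * G\<close> to formal combinations of pairs; it induces the
  multiplication map on the tensor product.
\<close>

definition mult_map :: "('k::field poly poly \<times> 'k poly poly \<Rightarrow>\<^sub>0 'k) \<Rightarrow> 'k poly poly"
  where "mult_map f = (\<Sum>u\<in>Poly_Mapping.keys f. const2 (Poly_Mapping.lookup f u) * (fst u * snd u))"

lemma mult_map_superset:
  assumes "finite A" "Poly_Mapping.keys f \<subseteq> A"
  shows "mult_map f = (\<Sum>u\<in>A. const2 (Poly_Mapping.lookup f u) * (fst u * snd u))"
  unfolding mult_map_def using assms
  by (intro sum.mono_neutral_left) (auto simp: in_keys_iff const2_hom)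

lemma mult_map_add: "mult_map (f + g) = mult_map f + mult_map g"
proof -
  let ?A = "Poly_Mapping.keys f \<union> Poly_Mapping.keys g"
  have "mult_map f = (\<Sum>u\<in>?A. const2 (Poly_Mapping.lookup f u) * (fst u * snd u))"
    "mult_map g = (\<Sum>u\<in>?A. const2 (Poly_Mapping.lookup g u) * (fst u * snd u))"
    "mult_map (f + g) = (\<Sum>u\<in>?A. const2 (Poly_Mapping.lookup (f + g) u) * (fst u * snd u))"
    using keys_add[of f g] by (intro mult_map_superset; auto)+
  then show ?thesis by (simp add: lookup_add const2_hom distrib_right sum.distrib)
qed

lemma mult_map_scale: "mult_map (Poly_Mapping.map ((*) c) f) = const2 c * mult_map f"
  using mult_map_superset[OF finite_keys keys_map_mult[of c f]]
  by (simp add: mult_map_def lookup_map_mult sum_distrib_left const2_hom mult.assoc)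

lemma mult_map_0 [simp]: "mult_map 0 = 0"
  by (simp add: mult_map_def)

lemma mult_map_single [simp]: "mult_map (Poly_Mapping.single (F, G) c) = const2 c * (F * G)"
  by (simp add: mult_map_def const2_hom)

lemma mult_map_uminus: "mult_map (- f) = - mult_map f"
  using mult_map_add[of f "- f"] by (simp add: eq_neg_iff_add_eq_0 add.commute)

lemma mult_map_diff: "mult_map (f - g) = mult_map f - mult_map g"
  using mult_map_add[of f "- g"] by (simp add: mult_map_uminus)

lemma mult_map_sum: "mult_map (sum f A) = (\<Sum>x\<in>A. mult_map (f x))"
  by (induction A rule: infinite_finite_induct) (simp_all add: mult_map_add)

lemma keys_sum_subset:
  assumes "\<And>x. x \<in> A \<Longrightarrow> Poly_Mapping.keys (f x) \<subseteq> C"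
  shows "Poly_Mapping.keys (sum f A) \<subseteq> C"
  using assms
proof (induction A rule: infinite_finite_induct)
  case (insert x A)
  then show ?case using keys_add[of "f x" "sum f A"] by auto
qed auto

lemma poly_mapping_sum_singles:
  "f = (\<Sum>u\<in>Poly_Mapping.keys f. Poly_Mapping.single u (Poly_Mapping.lookup f u))"
  by (rule poly_mapping_eqI) (auto simp: lookup_sum lookup_single when_def in_keys_iff)

text \<open>
  The isomorphism is induced by multiplication of forms. Modulo the bilinear relations every formal
  combination of pairs is equivalent to some \<open>\<Sum> (F k, w k)\<close>, because the \<open>w k\<close> span the second
  factor. If its image \<open>\<Sum> F k * w k\<close> is zero, the assumption on the \<open>w k\<close> makes all \<open>F k\<close> zero. So the
  kernel of multiplication is exactly the submodule of bilinear relations.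
\<close>

lemma tensor_forms_on_iso:
  fixes S T U :: "'k::field poly poly set" and w :: "nat \<Rightarrow> 'k poly poly"
  assumes S: "forms.subspace S" "\<And>g F. F \<in> S \<Longrightarrow> form_act g F \<in> S"
    and T: "T = forms.span (w ` {..i})" "\<And>g F. F \<in> T \<Longrightarrow> form_act g F \<in> T"
    and U: "forms.subspace U" "\<And>g F. F \<in> U \<Longrightarrow> form_act g F \<in> U"
    and mult: "\<And>F G. F \<in> S \<Longrightarrow> G \<in> T \<Longrightarrow> F * G \<in> U"
    and surj: "U \<subseteq> forms.span {F * G | F G. F \<in> S \<and> G \<in> T}"
    and inj: "\<And>F k. (\<And>k. k \<le> i \<Longrightarrow> F k \<in> S) \<Longrightarrow> (\<Sum>k\<le>i. F k * w k) = 0 \<Longrightarrow> k \<le> i \<Longrightarrow> F k = 0"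
  shows "forms_on U \<cong>\<^sub>M forms_on S \<otimes>\<^sub>M forms_on T"
proof -
  define V where "V = free_module (forms_on S) (forms_on T)"
  interpret V: Module.module field_ring V unfolding V_def by (rule free_module_module)
  have V [simp]: "carrier V = {f. Poly_Mapping.keys f \<subseteq> S \<times> T}" "\<And>f g. f \<oplus>\<^bsub>V\<^esub> g = f + g"
    "\<zero>\<^bsub>V\<^esub> = 0" "\<And>c f. c \<odot>\<^bsub>V\<^esub> f = Poly_Mapping.map ((*) c) f"
    by (simp_all add: V_def)
  have V_act: "act V g f = (\<Sum>u\<in>Poly_Mapping.keys f.
      Poly_Mapping.single (form_act g (fst u), form_act g (snd u)) (Poly_Mapping.lookup f u))" for g f
    by (simp add: V_def free_module_def case_prod_beta)
  have minus: "\<ominus>\<^bsub>V\<^esub> f = - f" if "f \<in> carrier V" for f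
  proof -
    have "- f \<in> carrier V" using that by (simp add: subset_iff in_keys_iff)
    then show ?thesis using that V.minus_equality[of "- f" f] by simp
  qed
  have Tsub: "forms.subspace T" by (simp add: T(1))
  note S_closed = S(1)[THEN forms.subspace_add] S(1)[THEN forms.subspace_scale]
    S(1)[THEN forms.subspace_0]
  note T_closed = Tsub[THEN forms.subspace_add] Tsub[THEN forms.subspace_scale]
    Tsub[THEN forms.subspace_0]
  have mult_map_U: "mult_map f \<in> U" if "f \<in> carrier V" for f
    unfolding mult_map_def using that U(1) mult
    by (intro forms.subspace_sum forms.subspace_scale) auto
  define K where "K = {f \<in> carrier V. mult_map f = 0}"
  define R where "R = bilinear_relations (forms_on S) (forms_on T)"
  define N where "N = (\<lambda>N. submodule N field_ring V) hull R"

  have K_submodule: "submodule K field_ring V"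
  proof (rule V.submoduleI)
    fix f assume "f \<in> K"
    then show "\<ominus>\<^bsub>V\<^esub> f \<in> K"
      using V.a_inv_closed[of f] minus[of f] by (simp add: K_def mult_map_uminus del: V(1))
  next
    fix f g assume "f \<in> K" "g \<in> K"
    then show "f \<oplus>\<^bsub>V\<^esub> g \<in> K"
      using V.a_closed[of f g] by (simp add: K_def mult_map_add del: V(1))
  next
    fix c f assume "f \<in> K"
    then show "c \<odot>\<^bsub>V\<^esub> f \<in> K"
      using V.smult_closed[of c f] by (simp add: K_def mult_map_scale del: V(1))
  qed (auto simp: K_def)
  have keys_single: "Poly_Mapping.keys (Poly_Mapping.single u c) \<subseteq> A \<longleftrightarrow> c \<noteq> 0 \<longrightarrow> u \<in> A"
    for u :: "'k poly poly \<times> 'k poly poly" and c :: 'k and A by simp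
  have diff_carrier: "f - g \<in> carrier V" if "f \<in> carrier V" "g \<in> carrier V" for f g
    using V.minus_closed[OF that] minus[OF that(2)] by (simp add: V.minus_eq)
  have "R \<subseteq> carrier V"
    unfolding R_def bilinear_relations_def Let_def
    by (auto simp del: V(1) intro!: diff_carrier) (auto simp: keys_single S_closed T_closed)
  moreover have "mult_map f = 0" if "f \<in> R" for f
    using that unfolding R_def bilinear_relations_def Let_def
    by (auto simp: mult_map_diff const2_hom distrib_left distrib_right mult_ac)
  ultimately have "R \<subseteq> K" by (auto simp: K_def)
  then have "N \<subseteq> K" unfolding N_def using K_submodule by (intro hull_minimal)
  have N: "submodule N field_ring V"
  proof -
    let ?F = "{t. submodule t field_ring V \<and> R \<subseteq> t}"
    have ne: "K \<in> ?F" using K_submodule \<open>R \<subseteq> K\<close> by simp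
    show ?thesis unfolding N_def hull_def
    proof (rule V.submoduleI)
      show "\<Inter>?F \<subseteq> carrier V" using ne V.submoduleE(1) by blast
      have "\<zero>\<^bsub>V\<^esub> \<in> t" if "submodule t field_ring V" for t
        using submodule.axioms(1)[OF that] subgroup.one_closed by fastforce
      then show "\<zero>\<^bsub>V\<^esub> \<in> \<Inter>?F" by blast
    qed (use V.submoduleE in auto)
  qed
  have RN: "f \<in> N" if "f \<in> R" for f using that hull_subset[of R] by (auto simp: N_def)
  have N_add: "f + g \<in> N" if "f \<in> N" "g \<in> N" for f g
    using V.submoduleE(5)[OF N that] by simp
  have N_diff: "f - g \<in> N" if "f \<in> N" "g \<in> N" for f g
    using N_add[OF that(1) V.submoduleE(3)[OF N that(2)]] minus[of g] V.submoduleE(1)[OF N] that(2)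
    by auto
  let ?e = "\<lambda>F G. Poly_Mapping.single (F, G) (1::'k)"
  note R_alt = R_def bilinear_relations_def Let_def forms_on_simps
  have rel_add1: "?e (F + F') G - ?e F G - ?e F' G \<in> N" if "F \<in> S" "F' \<in> S" "G \<in> T" for F F' G
    by (rule RN, unfold R_alt, rule UnI1, rule UnI1, rule UnI1) (use that in blast)
  have rel_add2: "?e F (G + G') - ?e F G - ?e F G' \<in> N" if "F \<in> S" "G \<in> T" "G' \<in> T" for F G G'
    by (rule RN, unfold R_alt, rule UnI1, rule UnI1, rule UnI2) (use that in blast)
  have rel_scale1: "?e (const2 c * F) G - Poly_Mapping.single (F, G) c \<in> N" if "F \<in> S" "G \<in> T" for c F G
    by (rule RN, unfold R_alt, rule UnI1, rule UnI2) (use that in blast)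
  have rel_scale2: "?e F (const2 c * G) - Poly_Mapping.single (F, G) c \<in> N" if "F \<in> S" "G \<in> T" for c F G
    by (rule RN, unfold R_alt, rule UnI2) (use that in blast)
  have N_0: "0 \<in> N" using rel_scale1[OF S_closed(3) T_closed(3), of 1] by (simp add: const2_hom)
  have N_commute: "g - f \<in> N" if "f - g \<in> N" for f g using N_diff[OF N_0 that] by simp
  have zero1: "?e 0 G \<in> N" if "G \<in> T" for G
    using rel_scale1[OF S_closed(3) that, of 0] by (simp add: const2_hom)
  have zero2: "?e F 0 \<in> N" if "F \<in> S" for F
    using rel_scale2[OF that T_closed(3), of 0] by (simp add: const2_hom)
  have w: "w k \<in> T" if "k \<le> i" for k using that by (auto simp: T(1) intro: forms.span_base)

  \<comment> \<open>\<open>P f\<close>: modulo the relations \<open>f\<close> has the normal form with second entries \<open>w k\<close>\<close>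
  define P where "P f \<longleftrightarrow> (\<exists>F. (\<forall>k\<le>i. F k \<in> S) \<and> f - (\<Sum>k\<le>i. ?e (F k) (w k)) \<in> N)" for f
  have sum_N: "sum h A \<in> N" if "\<And>x. x \<in> A \<Longrightarrow> h x \<in> N" for h :: "nat \<Rightarrow> _" and A
    using that by (induction A rule: infinite_finite_induct) (auto intro: N_add N_0)
  have P_cong: "P f" if "f - g \<in> N" "P g" for f g
  proof -
    obtain F where F: "\<forall>k\<le>i. F k \<in> S" "g - (\<Sum>k\<le>i. ?e (F k) (w k)) \<in> N"
      using \<open>P g\<close> by (auto simp: P_def)
    have "f - (\<Sum>k\<le>i. ?e (F k) (w k)) \<in> N" using N_add[OF that(1) F(2)] by simp
    then show ?thesis using F(1) unfolding P_def by blast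
  qed
  have P_N: "P f" if "f \<in> N" for f
  proof -
    have "(\<Sum>k\<le>i. ?e 0 (w k)) \<in> N" by (intro sum_N zero1 w) simp
    then show ?thesis unfolding P_def using N_diff[OF that] S_closed(3)
      by (intro exI[of _ "\<lambda>_. 0"]) simp
  qed
  have P_add: "P (f + g)" if "P f" "P g" for f g
  proof -
    obtain F where F: "\<forall>k\<le>i. F k \<in> S" "f - (\<Sum>k\<le>i. ?e (F k) (w k)) \<in> N"
      using \<open>P f\<close> by (auto simp: P_def)
    obtain G where G: "\<forall>k\<le>i. G k \<in> S" "g - (\<Sum>k\<le>i. ?e (G k) (w k)) \<in> N"
      using \<open>P g\<close> by (auto simp: P_def)
    have "(\<Sum>k\<le>i. ?e (F k + G k) (w k) - ?e (F k) (w k) - ?e (G k) (w k)) \<in> N"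
      by (intro sum_N rel_add1 w) (use F G in auto)
    from N_diff[OF N_add[OF F(2) G(2)] this]
    have "f + g - (\<Sum>k\<le>i. ?e (F k + G k) (w k)) \<in> N"
      by (simp add: sum_subtractf sum.distrib algebra_simps)
    then show ?thesis unfolding P_def using F(1) G(1) S_closed(1)
      by (intro exI[of _ "\<lambda>k. F k + G k"]) auto
  qed
  have P_base: "P (?e F (w k))" if "F \<in> S" "k \<le> i" for F k
  proof -
    define F' where "F' j = (if j = k then F else 0)" for j
    have "(\<Sum>j\<in>{..i} - {k}. ?e (F' j) (w j)) \<in> N"
      by (intro sum_N) (auto simp: F'_def zero1 w)
    moreover have "(\<Sum>j\<le>i. ?e (F' j) (w j)) = ?e F (w k) + (\<Sum>j\<in>{..i} - {k}. ?e (F' j) (w j))"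
      using that by (subst sum.remove[of _ k]) (auto simp: F'_def)
    ultimately have "?e F (w k) - (\<Sum>j\<le>i. ?e (F' j) (w j)) \<in> N"
      using N_diff[OF N_0] by simp
    then show ?thesis unfolding P_def using that S_closed(3)
      by (intro exI[of _ F']) (auto simp: F'_def)
  qed
  have P_scale: "P (Poly_Mapping.single (F, G) c)"
    if "F \<in> S" "G \<in> T" "\<And>F. F \<in> S \<Longrightarrow> P (?e F G)" for F G c
    using P_cong[OF N_commute[OF rel_scale1[OF that(1,2), of c]] that(3)[OF S_closed(2)[OF that(1)]]] .
  have "G \<in> T \<and> P (?e F G)" if F: "F \<in> S" and G: "G \<in> T" for F G
    using G unfolding T(1)
  proof (induction G rule: forms.span_induct_alt)
    case base
    show ?case using P_N[OF zero2[OF F]] T_closed(3) by (simp add: T(1))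
  next
    case (step c G H)
    then obtain k where k: "k \<le> i" "G = w k" by auto
    have GT: "G \<in> T" using k w by simp
    have HT: "H \<in> T" and PH: "P (?e F H)" using step(2) by (simp_all add: T(1))
    have "?e F (const2 c * G + H) - (Poly_Mapping.single (F, G) c + ?e F H) =
        (?e F (const2 c * G + H) - ?e F (const2 c * G) - ?e F H) +
        (?e F (const2 c * G) - Poly_Mapping.single (F, G) c)" by simp
    also have "\<dots> \<in> N"
      by (rule N_add[OF rel_add2[OF F T_closed(2)[OF GT] HT] rel_scale2[OF F GT]])
    finally have *: "?e F (const2 c * G + H) - (Poly_Mapping.single (F, G) c + ?e F H) \<in> N" .
    have "P (?e F' G)" if "F' \<in> S" for F' using P_base[OF that k(1)] k(2) by simp
    then have "P (Poly_Mapping.single (F, G) c)" by (rule P_scale[OF F GT])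
    from P_cong[OF * P_add[OF this PH]] have "P (?e F (const2 c * G + H))" .
    moreover have "const2 c * G + H \<in> T"
      by (rule T_closed(1)[OF T_closed(2)[OF GT] HT])
    ultimately show ?case by (simp add: T(1))
  qed
  then have P_pair: "P (?e F G)" if "F \<in> S" "G \<in> T" for F G using that by blast
  have P: "P f" if "f \<in> carrier V" for f
  proof -
    have "P (\<Sum>u\<in>A. Poly_Mapping.single u (h u))" if "A \<subseteq> S \<times> T" for A and h :: "_ \<Rightarrow> 'k"
      using that
    proof (induction A rule: infinite_finite_induct)
      case (insert u A)
      obtain F G where u: "u = (F, G)" by fastforce
      have FG: "F \<in> S" "G \<in> T" using insert.prems u by simp_all
      have "P (Poly_Mapping.single u (h u))"
        unfolding u by (rule P_scale[OF FG P_pair[OF _ FG(2)]])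
      moreover have "P (\<Sum>u\<in>A. Poly_Mapping.single u (h u))" using insert by simp
      ultimately show ?case unfolding sum.insert[OF insert.hyps] by (rule P_add)
    qed (simp_all add: P_N[OF N_0])
    then have "P (\<Sum>u\<in>Poly_Mapping.keys f. Poly_Mapping.single u (Poly_Mapping.lookup f u))"
      using that by simp
    then show ?thesis by (simp only: poly_mapping_sum_singles[symmetric])
  qed
  have "K \<subseteq> N"
  proof
    fix f assume f: "f \<in> K"
    then obtain F where F: "\<And>k. k \<le> i \<Longrightarrow> F k \<in> S" "f - (\<Sum>k\<le>i. ?e (F k) (w k)) \<in> N"
      using P[of f] unfolding P_def K_def by blast
    have "mult_map (f - (\<Sum>k\<le>i. ?e (F k) (w k))) = 0" "mult_map f = 0"
      using F(2) f \<open>N \<subseteq> K\<close> by (auto simp: K_def)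
    then have "(\<Sum>k\<le>i. F k * w k) = 0"
      by (simp add: mult_map_diff mult_map_sum const2_hom)
    then have "F k = 0" if "k \<le> i" for k using inj F(1) that by blast
    then have "(\<Sum>k\<le>i. ?e (F k) (w k)) \<in> N" by (intro sum_N) (auto intro: zero1 w)
    from N_add[OF F(2) this] show "f \<in> N" by simp
  qed
  with \<open>N \<subseteq> K\<close> have NK: "N = K" by blast

  have "forms_on U \<cong>\<^sub>M quotient_module V {f \<in> carrier V. mult_map f = \<zero>\<^bsub>forms_on U\<^esub>}"
  proof (rule quotient_by_kernel)
    show "Module.module field_ring V" by unfold_locales
    show "is_mat2_module (forms_on U)" using U by (rule forms_on_mat2_module)
    show "act V g f \<in> carrier V" if "f \<in> carrier V" for g f
    proof -
      have "Poly_Mapping.keys (act V g f) \<subseteq> S \<times> T"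
        unfolding V_act
      proof (rule keys_sum_subset)
        fix u assume "u \<in> Poly_Mapping.keys f"
        then have "fst u \<in> S" "snd u \<in> T" using that by auto
        then show "Poly_Mapping.keys (Poly_Mapping.single (form_act g (fst u), form_act g (snd u))
            (Poly_Mapping.lookup f u)) \<subseteq> S \<times> T"
          using S(2) T(2) by simp
      qed
      then show ?thesis by simp
    qed
    show "mult_map (act V g f) = act (forms_on U) g (mult_map f)" for g f
      unfolding V_act mult_map_sum mult_map_single forms_on_simps mult_map_def[of f] form_act_sum
      by (simp only: form_act_hom)
    show "mult_map ` carrier V = carrier (forms_on U)"
    proof (intro equalityI subsetI)
      fix F assume "F \<in> carrier (forms_on U)"
      then have "F \<in> forms.span {F * G | F G. F \<in> S \<and> G \<in> T}" using surj by auto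
      then show "F \<in> mult_map ` carrier V"
      proof (induction F rule: forms.span_induct_alt)
        case base
        show ?case by (intro image_eqI[of _ _ 0]) auto
      next
        case (step c H H')
        then obtain F G f where *: "H = F * G" "F \<in> S" "G \<in> T" "f \<in> carrier V" "H' = mult_map f"
          by auto
        then have "Poly_Mapping.single (F, G) c + f \<in> carrier V"
          using keys_add[of "Poly_Mapping.single (F, G) c" f] by (auto split: if_splits)
        then show ?case using * by (intro image_eqI) (simp_all add: mult_map_add del: V)
      qed
    qed (use mult_map_U in auto)
  qed (simp_all add: mult_map_add mult_map_scale)
  then show ?thesis
    unfolding tensor_module_def V_def[symmetric] R_def[symmetric] N_def[symmetric] NK K_def by simp
qed

section \<open>The modules generated by monomials\<close>

lemma GL2_submodule_iff:
  "GL2_submodule n S \<longleftrightarrow> forms.subspace S \<and> (\<forall>F\<in>S. homogeneous2 n F) \<and>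
    (\<forall>g. invertible g \<longrightarrow> (\<forall>F\<in>S. form_act g F \<in> S))"
proof -
  have sub: "forms.subspace {F :: 'a poly poly. homogeneous2 n F}"
    by (rule forms.subspaceI) (auto intro: homogeneous2_closed homogeneous2_const2_mult)
  interpret V: Module.module field_ring "V_mod n :: ('a, 'a poly poly) mat2_module"
    unfolding V_mod_def by (rule forms_on_module[OF sub])
  have V: "carrier (V_mod n) = {F :: 'a poly poly. homogeneous2 n F}"
    "\<And>F G. F \<oplus>\<^bsub>V_mod n\<^esub> G = F + (G :: 'a poly poly)" "\<zero>\<^bsub>V_mod n\<^esub> = (0 :: 'a poly poly)"
    "\<And>c F. c \<odot>\<^bsub>V_mod n\<^esub> F = const2 c * (F :: 'a poly poly)"
    by (simp_all add: V_mod_def)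
  have "submodule S field_ring (V_mod n) \<longleftrightarrow> forms.subspace S \<and> (\<forall>F\<in>S. homogeneous2 n F)"
  proof (intro iffI conjI ballI)
    assume *: "submodule S field_ring (V_mod n :: ('a, 'a poly poly) mat2_module)"
    note S = V.submoduleE[OF *]
    show "homogeneous2 n F" if "F \<in> S" for F using S(1) that by (auto simp: V)
    have "0 \<in> S"
      using subgroup.one_closed[OF submodule.axioms(1)[OF *]] by (simp add: V)
    then show "forms.subspace S" using S(4,5) by (auto simp: V intro!: forms.subspaceI)
  next
    assume *: "forms.subspace S \<and> (\<forall>F\<in>S. homogeneous2 n F)"
    have minus: "\<ominus>\<^bsub>V_mod n\<^esub> F = - F" if "F \<in> S" for F
      using that * forms.subspace_neg[of S F] V.minus_equality[of "- F" F] by (auto simp: V)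
    show "submodule S field_ring (V_mod n)"
      using * by (intro V.submoduleI)
        (auto simp: V minus forms.subspace_0 forms.subspace_add forms.subspace_scale forms.subspace_neg)
  qed
  then show ?thesis by (simp add: GL2_submodule_def)
qed

text \<open>
  The coefficients of \<open>(tX + Y)\<^sup>l\<close> as a polynomial in \<open>t\<close> are the monomials of degree \<open>l\<close> up to binomial
  coefficients, which are units for \<open>l < p\<close>; the \<open>p\<close> values of \<open>t\<close> suffice to isolate them.
\<close>

lemma linform_powers_span_multiples:
  fixes H :: "'k::{field,finite} poly poly"
  assumes pr: "Factorial_Ring.prime CARD('k)" and l: "l < CARD('k)" and S: "forms.subspace S"
    and powers: "\<And>t. H * linform (vector [t, 1]) ^ l \<in> S" and G: "homogeneous2 l G"
  shows "H * G \<in> S"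
proof -
  define D where "D k = H * (const2 (of_nat (l choose k)) * (varX ^ k * varY ^ (l - k)))" for k
  have D: "D k \<in> S" if "k \<le> l" for k
  proof (rule forms.coefficients_in_subspace[OF S finite[of UNIV] _ _ that])
    fix t :: 'k
    have "(\<Sum>k\<le>l. const2 (t ^ k) * D k) = H * linform (vector [t, 1]) ^ l"
      unfolding linform_def binomial_ring sum_distrib_left D_def
      by (intro sum.cong refl) (simp add: const2_hom const2_power const2_of_nat power_mult_distrib mult_ac)
    then show "(\<Sum>k\<le>l. const2 (t ^ k) * D k) \<in> S" using powers by simp
  qed (use l in simp)
  have mono: "H * (varX ^ k * varY ^ (l - k)) \<in> S" if "k \<le> l" for k
  proof -
    have "const2 (inverse (of_nat (l choose k))) * D k =
        const2 (inverse (of_nat (l choose k)) * of_nat (l choose k)) * (H * (varX ^ k * varY ^ (l - k)))"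
      unfolding D_def const2_hom by (simp only: mult_ac)
    also have "\<dots> = H * (varX ^ k * varY ^ (l - k))"
      using binomial_not_0_below_CARD[OF pr l that] by (simp add: const2_hom)
    finally show ?thesis using forms.subspace_scale[OF S D[OF that]] by metis
  qed
  have "H * G = (\<Sum>k\<le>l. const2 (coeff (coeff G (l - k)) k) * (H * (varX ^ k * varY ^ (l - k))))"
    by (subst homogeneous2_expansion[OF G]) (simp only: sum_distrib_left mult_ac)
  also have "\<dots> \<in> S" using S mono by (intro forms.subspace_sum forms.subspace_scale) auto
  finally show ?thesis .
qed

text \<open>
  For \<open>l < p\<close> and \<open>m \<ge> 1\<close> this is \<open>X\<^bsub>m,m+l\<^esub>\<close>, in a form whose stability under all matrices is evident.
\<close>

definition power_span :: "nat \<Rightarrow> nat \<Rightarrow> 'k::field poly poly set"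
  where "power_span m l = forms.span {linform v ^ m * G | v G. homogeneous2 l G}"

lemma power_span_subspace: "forms.subspace (power_span m l)"
  by (simp add: power_span_def)

lemma power_span_base: "homogeneous2 l G \<Longrightarrow> linform v ^ m * G \<in> power_span m l"
  unfolding power_span_def by (rule forms.span_base) blast

lemma power_span_minimal:
  assumes "forms.subspace S" "\<And>v G. homogeneous2 l G \<Longrightarrow> linform v ^ m * G \<in> S"
  shows "power_span m l \<subseteq> S"
  unfolding power_span_def using assms by (intro forms.span_minimal) auto

lemma subspace_form_act_vimage:
  "forms.subspace S \<Longrightarrow> forms.subspace {F. form_act g F \<in> S}"
  by (rule forms.subspaceI)
    (auto simp: form_act_hom forms.subspace_0 forms.subspace_add forms.subspace_scale)

lemma power_span_act: "F \<in> power_span m l \<Longrightarrow> form_act g F \<in> power_span m l"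
  using power_span_minimal[OF subspace_form_act_vimage[OF power_span_subspace], of l m g m l]
  by (auto simp: form_act_hom form_act_power form_act_linform
      intro!: power_span_base homogeneous2_form_act)

lemma power_span_homogeneous: "F \<in> power_span m l \<Longrightarrow> homogeneous2 (m + l) F"
proof -
  have "power_span m l \<subseteq> {F :: 'a poly poly. homogeneous2 (m + l) F}"
    by (rule power_span_minimal, rule forms.subspaceI)
      (auto intro: homogeneous2_closed homogeneous2_const2_mult homogeneous2_mult
        homogeneous2_linform_power)
  then show "F \<in> power_span m l \<Longrightarrow> homogeneous2 (m + l) F" by blast
qed

lemma exists_invertible_column:
  fixes v :: "'k::field ^ 2"
  assumes "v \<noteq> 0"
  obtains g :: "'k mat2" where "invertible g" "g *v axis 1 1 = v"
proof (cases "v $ 1 = 0")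
  case True
  then have "v $ 2 \<noteq> 0" using assms by (auto simp: vec_eq_iff forall_2)
  then show thesis using True
    by (intro that[of "vector [vector [v $ 1, 1], vector [v $ 2, 0]]"])
      (auto simp: invertible_det_nz det_2 matrix_vector_mult_def axis_def vec_eq_iff forall_2 sum_2)
next
  case False
  then show thesis
    by (intro that[of "vector [vector [v $ 1, 0], vector [v $ 2, 1]]"])
      (auto simp: invertible_det_nz det_2 matrix_vector_mult_def axis_def vec_eq_iff forall_2 sum_2)
qed

text \<open>
  Unipotent matrices fixing \<open>X\<close> turn \<open>X\<^sup>m Y\<^sup>l\<close> into \<open>X\<^sup>m (tX + Y)\<^sup>l\<close>, and these span \<open>X\<^sup>m V\<^sub>l\<close>. An invertible
  matrix taking \<open>X\<close> to \<open>L\<^sub>v\<close> then gives \<open>L\<^sub>v\<^sup>m V\<^sub>l\<close>. The vector \<open>v = 0\<close> contributes nothing as \<open>m \<ge> 1\<close>.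
\<close>

lemma GL2_hull_monomial:
  assumes pr: "Factorial_Ring.prime CARD('k::{field,finite})" and l: "l < CARD('k)" and m: "m \<ge> 1"
  shows "GL2_submodule (m + l) hull {varX ^ m * varY ^ l} = (power_span m l :: 'k poly poly set)"
proof (rule hull_unique)
  have "varX ^ m * varY ^ l = linform (axis 1 1) ^ m * (varY ^ l :: 'k poly poly)" by simp
  also have "\<dots> \<in> power_span m l"
    using homogeneous2_monomial[of 0 l] by (intro power_span_base) simp
  finally show "{varX ^ m * varY ^ l} \<subseteq> (power_span m l :: 'k poly poly set)" by simp
  show "GL2_submodule (m + l) (power_span m l :: 'k poly poly set)"
    unfolding GL2_submodule_iff
    using power_span_subspace power_span_homogeneous power_span_act by blast
next
  fix S :: "'k poly poly set"
  assume X: "{varX ^ m * varY ^ l} \<subseteq> S" and "GL2_submodule (m + l) S"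
  then have S: "forms.subspace S" "\<And>g F. invertible g \<Longrightarrow> F \<in> S \<Longrightarrow> form_act g F \<in> S"
    by (auto simp: GL2_submodule_iff)
  have *: "varX ^ m * G \<in> S" if "homogeneous2 l G" for G
  proof (rule linform_powers_span_multiples[OF pr l S(1) _ that])
    fix t :: 'k
    define g :: "'k mat2" where "g = vector [vector [1, t], vector [0, 1]]"
    have "invertible g" by (simp add: g_def invertible_det_nz det_2)
    moreover have "g *v axis 1 1 = axis 1 1" "g *v axis 2 1 = vector [t, 1]"
      by (auto simp: g_def matrix_vector_mult_def axis_def vec_eq_iff forall_2 sum_2)
    then have "form_act g (varX ^ m * varY ^ l) = varX ^ m * linform (vector [t, 1]) ^ l"
      by (simp add: form_act_hom form_act_power form_act_var)
    ultimately show "varX ^ m * linform (vector [t, 1]) ^ l \<in> S"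
      using S(2)[of g "varX ^ m * varY ^ l"] X by simp
  qed
  show "power_span m l \<subseteq> S"
  proof (rule power_span_minimal[OF S(1)])
    fix v and G :: "'k poly poly" assume G: "homogeneous2 l G"
    show "linform v ^ m * G \<in> S"
    proof (cases "v = 0")
      case True
      then have "linform v = 0" by (simp add: linform_def const2_hom)
      then show ?thesis using m forms.subspace_0[OF S(1)] by (simp add: power_0_left)
    next
      case False
      then obtain g :: "'k mat2" where g: "invertible g" "g *v axis 1 1 = v"
        by (rule exists_invertible_column)
      then obtain h where h: "g ** h = mat 1" by (auto simp: invertible_def)
      have "form_act g (varX ^ m * form_act h G) = linform v ^ m * G"
        using g(2) h by (simp add: form_act_hom form_act_power form_act_var form_act_one
            flip: form_act_mult)
      then show ?thesis
        using S(2)[OF g(1) *[OF homogeneous2_form_act[OF G, of h]]] by simp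
    qed
  qed
qed

lemma X_mod_eq:
  assumes "Factorial_Ring.prime CARD('k::{field,finite})" "l < CARD('k)" "m \<ge> 1"
  shows "X_mod m (m + l) = (forms_on (power_span m l) :: ('k, 'k poly poly) mat2_module)"
  using GL2_hull_monomial[OF assms] by (simp add: X_mod_def)

lemma V_mod_eq_span:
  "{F :: 'k::field poly poly. homogeneous2 i F} = forms.span ((\<lambda>k. varX ^ k * varY ^ (i - k)) ` {..i})"
proof (intro equalityI subsetI)
  fix F :: "'k poly poly" assume "F \<in> {F. homogeneous2 i F}"
  then have "homogeneous2 i F" by simp
  then have "F = (\<Sum>k\<le>i. const2 (coeff (coeff F (i - k)) k) * (varX ^ k * varY ^ (i - k)))"
    by (rule homogeneous2_expansion)
  also have "\<dots> \<in> forms.span ((\<lambda>k. varX ^ k * varY ^ (i - k)) ` {..i})"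
    by (intro forms.span_sum, rule forms.span_scale, rule forms.span_base) simp
  finally show "F \<in> forms.span ((\<lambda>k. varX ^ k * varY ^ (i - k)) ` {..i})" .
next
  fix F :: "'k poly poly" assume "F \<in> forms.span ((\<lambda>k. varX ^ k * varY ^ (i - k)) ` {..i})"
  moreover have "forms.span ((\<lambda>k. varX ^ k * varY ^ (i - k)) ` {..i}) \<subseteq> {F :: 'k poly poly. homogeneous2 i F}"
  proof (rule forms.span_minimal)
    show "forms.subspace {F :: 'k poly poly. homogeneous2 i F}"
      by (rule forms.subspaceI) (auto intro: homogeneous2_closed homogeneous2_const2_mult)
    show "(\<lambda>k. varX ^ k * varY ^ (i - k)) ` {..i} \<subseteq> {F :: 'k poly poly. homogeneous2 i F}"
    proof (rule image_subsetI)
      fix k assume "k \<in> {..i}"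
      then show "varX ^ k * varY ^ (i - k) \<in> {F :: 'k poly poly. homogeneous2 i F}"
        using homogeneous2_monomial[of k "i - k"] by simp
    qed
  qed
  ultimately show "F \<in> {F. homogeneous2 i F}" by blast
qed

lemma power_span_0_digit_expansion:
  assumes "digit_basis n \<epsilon>" and "F \<in> (power_span n 0 :: 'k::{field,finite} poly poly set)"
  obtains \<alpha> where "F = (\<Sum>j\<le>digit_sum CARD('k) n. const2 (\<alpha> j) * \<epsilon> j)"
proof -
  let ?S = "forms.span (\<epsilon> ` {..digit_sum CARD('k) n})"
  have "power_span n 0 \<subseteq> ?S"
  proof (rule power_span_minimal)
    fix v and G :: "'k poly poly" assume "homogeneous2 0 G"
    then have "G = const2 (coeff (coeff G 0) 0)"
      using homogeneous2_expansion[of 0 G] by simp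
    moreover have "linform v ^ n \<in> ?S"
    proof -
      have "linform v ^ n = (\<Sum>j\<le>digit_sum CARD('k) n.
          const2 (v $ 1 ^ j * v $ 2 ^ (digit_sum CARD('k) n - j)) * \<epsilon> j)"
        using assms(1) by (simp add: digit_basis_def)
      also have "\<dots> \<in> ?S"
        by (intro forms.span_sum, rule forms.span_scale, rule forms.span_base) simp
      finally show ?thesis .
    qed
    ultimately show "linform v ^ n * G \<in> ?S"
      using forms.span_scale by (metis mult.commute)
  qed simp
  then have "F \<in> ?S" using assms(2) by blast
  then have "\<exists>\<alpha>. F = (\<Sum>j\<le>digit_sum CARD('k) n. const2 (\<alpha> j) * \<epsilon> j)"
  proof (induction F rule: forms.span_induct_alt)
    case base
    show ?case by (intro exI[of _ "\<lambda>_. 0"]) (simp add: const2_hom)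
  next
    case (step c G H)
    then obtain k \<alpha> where k: "k \<le> digit_sum CARD('k) n" "G = \<epsilon> k"
      and H: "H = (\<Sum>j\<le>digit_sum CARD('k) n. const2 (\<alpha> j) * \<epsilon> j)" by auto
    have "(\<Sum>j\<le>digit_sum CARD('k) n. const2 (\<alpha> j + (if j = k then c else 0)) * \<epsilon> j) =
        (\<Sum>j\<le>digit_sum CARD('k) n. if j = k then const2 c * \<epsilon> k else 0) + H"
      unfolding H sum.distrib[symmetric] by (intro sum.cong refl) (simp add: const2_hom distrib_right)
    also have "\<dots> = const2 c * G + H" using k by simp
    finally show ?case by metis
  qed
  then show thesis using that by blast
qed

lemma power_span_mult:
  assumes F: "F \<in> power_span n 0" and G: "homogeneous2 i G"
  shows "F * G \<in> power_span n i"
proof -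
  have "power_span n 0 \<subseteq> {F. F * G \<in> power_span n i}"
  proof (rule power_span_minimal)
    show "forms.subspace {F. F * G \<in> power_span n i}"
      by (rule forms.subspaceI) (auto simp: distrib_right mult.assoc
        intro: power_span_subspace[THEN forms.subspace_0] power_span_subspace[THEN forms.subspace_add]
          power_span_subspace[THEN forms.subspace_scale])
    show "linform v ^ n * H \<in> {F. F * G \<in> power_span n i}" if "homogeneous2 0 H" for v H
      using power_span_base[OF homogeneous2_mult[OF that, of i G], of v n] G by (simp add: mult.assoc)
  qed
  then show ?thesis using F by blast
qed

lemma linform_power_in_power_span: "linform v ^ n \<in> power_span n 0"
  using power_span_base[OF homogeneous2_closed(2)[of 1], of v n] by (simp add: const2_hom)

text \<open>
  By \<open>product_expansion\<close> an element of the kernel of multiplication is a solution of the homogeneous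
  linear system with binomial coefficients, hence zero for \<open>i \<le> S m\<close>. Injectivity holds even on the
  span of the digit basis, which can be larger than \<open>X\<^bsub>n,n\<^esub>\<close>.
\<close>

lemma X_mod_tensor_V_mod:
  assumes pr: "Factorial_Ring.prime CARD('k::{field,finite})"
    and d: "d + i < CARD('k)" and i: "i \<le> digit_sum CARD('k) m" and n: "d + CARD('k) * m \<ge> 1"
  defines "n \<equiv> d + CARD('k) * m"
  shows "(X_mod n (n + i) :: ('k, 'k poly poly) mat2_module) \<cong>\<^sub>M X_mod n n \<otimes>\<^sub>M V_mod i"
proof -
  define s where "s = digit_sum CARD('k) m"
  obtain \<epsilon> :: "nat \<Rightarrow> 'k poly poly" where \<epsilon>: "digit_basis m \<epsilon>" by (rule digit_basis_exists[OF pr])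
  have d': "d < CARD('k)" and i': "i < CARD('k)" using d by simp_all
  let ?D = "adjoin_digit d s \<epsilon>"
  have D: "digit_basis n ?D"
    unfolding n_def s_def by (rule digit_basis_adjoin_digit[OF pr d' \<epsilon>])
  have "CARD('k) \<ge> 2" using pr by (rule prime_ge_2_nat)
  then have sn: "digit_sum CARD('k) n = d + s"
    using d' by (subst digit_sum_rec) (simp_all add: s_def n_def)
  have X: "X_mod n (n + i) = (forms_on (power_span n i) :: ('k, 'k poly poly) mat2_module)"
    "X_mod n n = (forms_on (power_span n 0) :: ('k, 'k poly poly) mat2_module)"
    using X_mod_eq[OF pr i', of n] X_mod_eq[OF pr, of 0 n] n by (simp_all add: n_def)
  have "(forms_on (power_span n i) :: ('k, 'k poly poly) mat2_module) \<cong>\<^sub>M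
      forms_on (power_span n 0) \<otimes>\<^sub>M forms_on {F. homogeneous2 i F}"
  proof (rule tensor_forms_on_iso[OF power_span_subspace power_span_act V_mod_eq_span _
        power_span_subspace power_span_act])
    show "form_act g F \<in> {F. homogeneous2 i F}" if "F \<in> {F. homogeneous2 i F}" for g and F :: "'k poly poly"
      using that homogeneous2_form_act by blast
    fix F G :: "'k poly poly" assume F: "F \<in> power_span n 0" and G: "G \<in> {F. homogeneous2 i F}"
    then show "F * G \<in> power_span n i" using power_span_mult by blast
  next
    show "power_span n i \<subseteq> forms.span {F * G |F G :: 'k poly poly. F \<in> power_span n 0 \<and> G \<in> {F. homogeneous2 i F}}"
      using linform_power_in_power_span
      by (intro power_span_minimal forms.subspace_span forms.span_base) blast
  next
    fix F :: "nat \<Rightarrow> 'k poly poly" and k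
    assume F: "\<And>k. k \<le> i \<Longrightarrow> F k \<in> power_span n 0"
      and zero: "(\<Sum>k\<le>i. F k * (varX ^ k * varY ^ (i - k))) = 0" and k: "k \<le> i"
    have "\<exists>\<alpha>. F k = (\<Sum>j\<le>d + s. const2 (\<alpha> j) * ?D j)" if "k \<le> i" for k
      using power_span_0_digit_expansion[OF D F[OF that]] unfolding sn by metis
    then obtain \<alpha> where \<alpha>: "\<And>k. k \<le> i \<Longrightarrow> F k = (\<Sum>j\<le>d + s. const2 (\<alpha> k j) * ?D j)" by metis
    have "(\<Sum>k\<le>i. (\<Sum>j\<le>d + s. const2 (\<alpha> k j) * ?D j) * (varX ^ k * varY ^ (i - k))) = 0"
      using zero \<alpha> by simp
    note zero' = this[unfolded product_expansion[OF pr, where a = "\<lambda>j k. \<alpha> k j"]]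
    have "\<alpha> k j = 0" if "j \<le> d + s" for j
    proof (rule binomial_system_injective[where a = "\<lambda>j k. \<alpha> k j" and n = d and s = s, OF _ _ _ that k])
      show "inj_on (of_nat :: nat \<Rightarrow> 'k) {..d + i}" by (rule inj_on_of_nat_prime_field[OF pr d])
      show "i \<le> s" using i by (simp add: s_def)
      fix c b assume c: "c \<le> d + i" and b: "b \<le> s"
      show "(\<Sum>l\<le>d. \<Sum>k\<le>i. if l + k = c then of_nat (d choose l) * \<alpha> k (l + b) else 0) = 0"
        by (rule digit_basis_independent[OF \<epsilon> monomials_independent_over_frobenius[OF pr d zero' c, unfolded s_def]])
          (use b in \<open>simp add: s_def\<close>)
    qed
    then show "F k = 0" using \<alpha>[OF k] by (simp add: const2_hom)
  qed
  then show ?thesis unfolding X V_mod_def .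
qed

section \<open>Stabilisation and the isomorphism\<close>

text \<open>
  If there are at most \<open>p\<close> digit coefficients, the \<open>p\<close> powers \<open>(tX + Y)\<^sup>n\<close> determine them.
\<close>

lemma digit_basis_in_power_span:
  assumes \<epsilon>: "digit_basis n \<epsilon>"
    and s: "digit_sum CARD('k::{field,finite}) n < CARD('k)" and j: "j \<le> digit_sum CARD('k) n"
  shows "\<epsilon> j \<in> (power_span n 0 :: 'k poly poly set)"
proof (rule forms.coefficients_in_subspace[OF power_span_subspace finite[of UNIV] _ _ j])
  fix t :: 'k
  have "(\<Sum>j\<le>digit_sum CARD('k) n. const2 (t ^ j) * \<epsilon> j) = linform (vector [t, 1]) ^ n"
    using \<epsilon> by (simp add: digit_basis_def)
  then show "(\<Sum>j\<le>digit_sum CARD('k) n. const2 (t ^ j) * \<epsilon> j) \<in> power_span n 0"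
    by (simp add: linform_power_in_power_span)
qed (use s in simp)

text \<open>
  A solution of the linear system with a unit vector as right-hand side writes this product as a sum
  of products of a digit coefficient of exponent \<open>r - s + pm\<close> and a monomial of degree \<open>s\<close>. The digit
  sum of that exponent is \<open>r < p\<close>, so its digit coefficients lie in the span of the powers.
\<close>

lemma monomial_times_digit_basis_in_power_span:
  assumes pr: "Factorial_Ring.prime CARD('k::{field,finite})" and \<epsilon>: "digit_basis m \<epsilon>"
    and s: "s = digit_sum CARD('k) m" "s \<le> r" and r: "r < CARD('k)" and c: "c \<le> r" and b: "b \<le> s"
  shows "varX ^ c * varY ^ (r - c) * \<epsilon> b ^ CARD('k) \<in>
    (power_span (r - s + CARD('k) * m) s :: 'k poly poly set)"
proof -
  let ?p = "CARD('k)"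
  define d where "d = r - s"
  define n where "n = d + ?p * m"
  have d: "d < ?p" "r = d + s" using s r by (auto simp: d_def)
  let ?D = "adjoin_digit d s \<epsilon>"
  have D: "digit_basis n ?D"
    unfolding n_def s(1) by (rule digit_basis_adjoin_digit[OF pr d(1) \<epsilon>])
  have "?p \<ge> 2" using pr by (rule prime_ge_2_nat)
  then have sn: "digit_sum ?p n = d + s"
    using d(1) by (subst digit_sum_rec) (simp_all add: s(1) n_def)
  obtain a :: "nat \<Rightarrow> nat \<Rightarrow> 'k" where a: "\<And>c' b'. c' \<le> d + s \<Longrightarrow> b' \<le> s \<Longrightarrow>
      (\<Sum>l\<le>d. \<Sum>k\<le>s. if l + k = c' then of_nat (d choose l) * a (l + b') k else 0) =
      (if c' = c \<and> b' = b then 1 else 0)"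
    using binomial_system_solvable[OF inj_on_of_nat_prime_field[OF pr r[unfolded d(2)]],
      where A = "\<lambda>c' b'. if c' = c \<and> b' = b then 1 else 0"] by blast
  have "(\<Sum>k\<le>s. (\<Sum>j\<le>d + s. const2 (a j k) * ?D j) * (varX ^ k * varY ^ (s - k))) \<in> power_span n s"
  proof (rule forms.subspace_sum[OF power_span_subspace], rule power_span_mult)
    fix k assume "k \<in> {..s}"
    then show "homogeneous2 s (varX ^ k * varY ^ (s - k))"
      using homogeneous2_monomial[of k "s - k"] by simp
    show "(\<Sum>j\<le>d + s. const2 (a j k) * ?D j) \<in> power_span n 0"
    proof (rule forms.subspace_sum[OF power_span_subspace])
      fix j assume "j \<in> {..d + s}"
      then have "?D j \<in> power_span n 0"
        using r by (intro digit_basis_in_power_span[OF D]) (simp_all add: sn d(2))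
      then show "const2 (a j k) * ?D j \<in> power_span n 0"
        by (rule forms.subspace_scale[OF power_span_subspace])
    qed
  qed
  also have "(\<Sum>k\<le>s. (\<Sum>j\<le>d + s. const2 (a j k) * ?D j) * (varX ^ k * varY ^ (s - k))) =
      (\<Sum>c'\<le>d + s. varX ^ c' * varY ^ (d + s - c') *
        (\<Sum>b'\<le>s. const2 (if c' = c \<and> b' = b then 1 else 0) * \<epsilon> b') ^ ?p)"
    unfolding product_expansion[OF pr]
  proof (intro sum.cong refl)
    fix c' assume c': "c' \<in> {..d + s}"
    have "(\<Sum>b'\<le>s. const2 (\<Sum>l\<le>d. \<Sum>k\<le>s. if l + k = c' then of_nat (d choose l) * a (l + b') k else 0)
        * \<epsilon> b') = (\<Sum>b'\<le>s. const2 (if c' = c \<and> b' = b then 1 else 0) * \<epsilon> b')"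
      using a c' by (intro sum.cong refl) simp
    then show "varX ^ c' * varY ^ (d + s - c') * (\<Sum>b'\<le>s. const2
        (\<Sum>l\<le>d. \<Sum>k\<le>s. if l + k = c' then of_nat (d choose l) * a (l + b') k else 0) * \<epsilon> b') ^ ?p =
      varX ^ c' * varY ^ (d + s - c') *
        (\<Sum>b'\<le>s. const2 (if c' = c \<and> b' = b then 1 else 0) * \<epsilon> b') ^ ?p"
      by (simp only:)
  qed
  also have "\<dots> = (\<Sum>c'\<le>d + s. if c' = c then varX ^ c * varY ^ (d + s - c) * \<epsilon> b ^ ?p else 0)"
  proof (intro sum.cong refl)
    fix c'
    have "(\<Sum>b'\<le>s. const2 (if c' = c \<and> b' = b then 1 else 0) * \<epsilon> b') =
        (\<Sum>b'\<le>s. if b' = b then if c' = c then \<epsilon> b else 0 else 0)"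
      by (intro sum.cong refl) (auto simp: const2_hom)
    also have "\<dots> = (if c' = c then \<epsilon> b else 0)" using b by simp
    finally show "varX ^ c' * varY ^ (d + s - c') *
        (\<Sum>b'\<le>s. const2 (if c' = c \<and> b' = b then 1 else 0) * \<epsilon> b') ^ ?p =
        (if c' = c then varX ^ c * varY ^ (d + s - c) * \<epsilon> b ^ ?p else 0)"
      by (simp add: power_0_left)
  qed
  also have "\<dots> = varX ^ c * varY ^ (r - c) * \<epsilon> b ^ ?p" using c by (simp add: d(2))
  finally show ?thesis by (simp add: n_def d_def)
qed

text \<open>
  Enlarging \<open>i\<close> enlarges the module, since part of the power of \<open>L\<^sub>v\<close> can be absorbed in the second
  factor. On the other hand all these modules lie in the span of the products \<open>X\<^sup>c Y\<^bsup>r-c\<^esup> \<epsilon>\<^sub>b\<^sup>p\<close>, which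
  is already reached for \<open>i = s\<close>.
\<close>

lemma power_span_stabilises:
  assumes pr: "Factorial_Ring.prime CARD('k::{field,finite})"
    and s: "s = digit_sum CARD('k) m" "s \<le> i" "i \<le> r" and r: "r < CARD('k)"
  shows "power_span (r - i + CARD('k) * m) i =
    (power_span (r - s + CARD('k) * m) s :: 'k poly poly set)"
proof (rule equalityI)
  let ?p = "CARD('k)"
  obtain \<epsilon> :: "nat \<Rightarrow> 'k poly poly" where \<epsilon>: "digit_basis m \<epsilon>" by (rule digit_basis_exists[OF pr])
  have sr: "s \<le> r" using s by simp
  show "power_span (r - i + ?p * m) i \<subseteq> (power_span (r - s + ?p * m) s :: 'k poly poly set)"
  proof (rule power_span_minimal[OF power_span_subspace])
    fix v and G :: "'k poly poly" assume G: "homogeneous2 i G"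
    define H where "H = linform v ^ (r - i) * G"
    have H: "homogeneous2 r H"
      using homogeneous2_mult[OF homogeneous2_linform_power G, of "r - i" v] s by (simp add: H_def)
    have "linform v ^ (r - i + ?p * m) * G = H * (linform v ^ m) ^ ?p"
      by (simp add: H_def power_add mult_ac flip: power_mult)
    also have "(linform v ^ m) ^ ?p =
        (\<Sum>b\<le>s. const2 (v $ 1 ^ b * v $ 2 ^ (s - b)) * \<epsilon> b ^ ?p)"
      using \<epsilon> by (simp add: digit_basis_def s(1) form_frobenius[OF pr] power_mult_distrib const2_power_CARD)
    also have "H * \<dots> = (\<Sum>c\<le>r. \<Sum>b\<le>s. const2 (coeff (coeff H (r - c)) c) *
        (const2 (v $ 1 ^ b * v $ 2 ^ (s - b)) * (varX ^ c * varY ^ (r - c) * \<epsilon> b ^ ?p)))"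
      by (subst homogeneous2_expansion[OF H]) (simp only: sum_product mult_ac)
    also have "\<dots> \<in> power_span (r - s + ?p * m) s"
      by (intro forms.subspace_sum[OF power_span_subspace] forms.subspace_scale[OF power_span_subspace]
          monomial_times_digit_basis_in_power_span[OF pr \<epsilon> s(1) sr r]) auto
    finally show "linform v ^ (r - i + ?p * m) * G \<in> power_span (r - s + ?p * m) s" .
  qed
  show "power_span (r - s + ?p * m) s \<subseteq> (power_span (r - i + ?p * m) i :: 'k poly poly set)"
  proof (rule power_span_minimal[OF power_span_subspace])
    fix v and G :: "'k poly poly" assume G: "homogeneous2 s G"
    have "r - s + ?p * m = (r - i + ?p * m) + (i - s)" using s by simp
    then have "linform v ^ (r - s + ?p * m) * G = linform v ^ (r - i + ?p * m) * (linform v ^ (i - s) * G)"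
      by (simp only: power_add mult.assoc)
    also have "\<dots> \<in> power_span (r - i + ?p * m) i"
      using homogeneous2_mult[OF homogeneous2_linform_power G, of "i - s" v] s
      by (intro power_span_base) simp
    finally show "linform v ^ (r - s + ?p * m) * G \<in> power_span (r - i + ?p * m) i" .
  qed
qed

theorem theorem3p9:
  fixes p r r\<^sub>0 i :: nat
  assumes "Factorial_Ring.prime p" and "p \<ge> 3" and "CARD('k::{field,finite}) = p"
    and "i \<le> p - 1" and "p \<le> r" and "[r = r\<^sub>0] (mod p)" and "r\<^sub>0 \<le> p - 1"
    and "i \<le> r\<^sub>0"
  shows "(X_mod (r - i) r :: ('k, 'k poly poly) mat2_module) \<cong>\<^sub>M
    (if digit_sum p (r - i) < r\<^sub>0
     then X_mod (r - digit_sum p (r - r\<^sub>0)) (r - digit_sum p (r - r\<^sub>0))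
            \<otimes>\<^sub>M V_mod (digit_sum p (r - r\<^sub>0))
     else X_mod (r - i) (r - i) \<otimes>\<^sub>M V_mod i)"
proof -
  have p: "p = CARD('k)" using assms(3) by simp
  have pr: "Factorial_Ring.prime CARD('k)" using assms(1) p by simp
  define m where "m = r div p"
  define s where "s = digit_sum p m"
  have r0: "r\<^sub>0 < p" "r\<^sub>0 = r mod p"
    using assms(2,6,7) by (auto simp: cong_def)
  have r: "r = r\<^sub>0 + p * m" by (simp add: r0(2) m_def)
  have pm: "p * m \<ge> 1" using assms(2,5) by (auto simp: m_def div_greater_zero_iff Suc_le_eq)
  have sub: "r - j = r\<^sub>0 - j + p * m" if "j \<le> r\<^sub>0" for j using that r by simp
  have digits: "digit_sum p (r - j) = (r\<^sub>0 - j) + s" if "j \<le> r\<^sub>0" for j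
    unfolding sub[OF that] using r0(1) assms(2) by (subst digit_sum_rec) (simp_all add: s_def)
  have tensor: "(X_mod (r - j) r :: ('k, 'k poly poly) mat2_module) \<cong>\<^sub>M X_mod (r - j) (r - j) \<otimes>\<^sub>M V_mod j"
    if "j \<le> r\<^sub>0" "j \<le> s" for j
  proof -
    have "r\<^sub>0 - j + j < CARD('k)" "j \<le> digit_sum CARD('k) m"
      using that r0(1) by (simp_all add: s_def flip: p)
    moreover have "r\<^sub>0 - j + CARD('k) * m \<ge> 1"
      using pm unfolding p by (rule trans_le_add2)
    ultimately show ?thesis
      using X_mod_tensor_V_mod[OF pr, of "r\<^sub>0 - j" j m] that(1) r by (simp add: sub flip: p)
  qed
  show ?thesis
  proof (cases "s < i")
    case True
    have X: "X_mod (r - j) r = (forms_on (power_span (r - j) j) :: ('k, 'k poly poly) mat2_module)"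
      if "j \<le> r\<^sub>0" for j
    proof -
      have "r - j \<ge> 1" unfolding sub[OF that] using pm by (rule trans_le_add2)
      then show ?thesis
        using X_mod_eq[OF pr, of j "r - j"] that r0(1) r by (simp flip: p)
    qed
    have "power_span (r - i) i = (power_span (r - s) s :: 'k poly poly set)"
      using power_span_stabilises[OF pr, of s m i r\<^sub>0] True assms(8) r0(1) sub[of i] sub[of s]
      by (simp add: s_def flip: p)
    then have "(X_mod (r - i) r :: ('k, 'k poly poly) mat2_module) = X_mod (r - s) r"
      using X[of i] X[of s] True assms(8) by simp
    moreover have "digit_sum p (r - i) < r\<^sub>0" "digit_sum p (r - r\<^sub>0) = s"
      using digits[of i] digits[of "r\<^sub>0"] True assms(8) by simp_all
    ultimately show ?thesis using tensor[of s] True assms(8) by simp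
  next
    case False
    then have "\<not> digit_sum p (r - i) < r\<^sub>0" using digits[of i] assms(8) by simp
    then show ?thesis using tensor[of i] False assms(8) by simp
  qed
qed

end
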